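(* Let $S^1=\{(x_1,x_2)\in\mathbb R^2:x_1^2+x_2^2=1\}$. Let $\psi$ be a real, positive, decreasing function such that $r^2\psi(r)\to0$ as $r\to\infty$, and let $W(S^1;\psi)$ be the set of $(x_1,x_2)\in S^1$ for which there exist infinitely many $(p_1,p_2,q)\in\mathbb Z^2\times\mathbb Z$, $q\ne0$, with $|x_i-p_i/q|<\psi(|q|)$ for $i=1,2$. Let $f$ be a dimension function such that $r^{-1}f(r)\to\infty$ as $r\to0$ and $r^{-1}f(r)$ is decreasing. Then $$\mathcal H^f(W(S^1;\psi))=\begin{cases}0&\text{if }\sum_{r=1}^\infty f(\psi(r))<\infty,\\ \infty&\text{if }\sum_{r=1}^\infty f(\psi(r))=\infty.\end{cases}$$
   Context: A dimension function is an increasing continuous $f:\mathbb R^+\to\mathbb R^+$ with $f(r)\to0$ as $r\to0$; $\mathcal H^f(F)=\lim_{\rho\to0}\inf\sum_if(r_i)$, infimum over countable covers of $F$ by (Euclidean) balls of radii $r_i\le\rho$. *)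

theory Defs
  imports "HOL-Analysis.Analysis"
begin

text \<open>
  The positive reals are \<open>{0<..}\<close>; nothing is assumed about the values of a dimension function
  elsewhere. \<open>Increasing\<close> is read in the weak sense.
\<close>

definition dimension_function :: "(real \<Rightarrow> real) \<Rightarrow> bool" where
  "dimension_function f \<longleftrightarrow>
     (\<forall>r>0. f r > 0) \<and> mono_on {0<..} f \<and> continuous_on {0<..} f \<and> (f \<longlongrightarrow> 0) (at_right 0)"

text \<open>
  The index set \<open>I\<close> is an arbitrary set of naturals, so finite covers are included.
\<close>

definition hausdorff_premeasure ::
    "(real \<Rightarrow> real) \<Rightarrow> real \<Rightarrow> 'a::metric_space set \<Rightarrow> ennreal" where
  "hausdorff_premeasure f \<rho> F =
     Inf {\<Sum>\<^sub>\<infinity>i\<in>I. ennreal (f (r i)) | (I :: nat set) (c :: nat \<Rightarrow> 'a) (r :: nat \<Rightarrow> real).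
            (\<forall>i\<in>I. 0 < r i \<and> r i \<le> \<rho>) \<and> F \<subseteq> (\<Union>i\<in>I. ball (c i) (r i))}"

definition hausdorff_measure :: "(real \<Rightarrow> real) \<Rightarrow> 'a::metric_space set \<Rightarrow> ennreal" where
  "hausdorff_measure f F = Lim (at_right 0) (\<lambda>\<rho>. hausdorff_premeasure f \<rho> F)"

lemma hausdorff_premeasure_antimono:
  fixes F :: "'a::metric_space set"
  assumes "\<rho> \<le> \<rho>'"
  shows "hausdorff_premeasure f \<rho>' F \<le> hausdorff_premeasure f \<rho> F"
  unfolding hausdorff_premeasure_def
proof (rule Inf_superset_mono, rule subsetI, clarify)
  fix I :: "nat set" and c :: "nat \<Rightarrow> 'a" and r :: "nat \<Rightarrow> real"
  assume "\<forall>i\<in>I. 0 < r i \<and> r i \<le> \<rho>" and "F \<subseteq> (\<Union>i\<in>I. ball (c i) (r i))"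
  then show "\<exists>(I' :: nat set) (c' :: nat \<Rightarrow> 'a) r'.
      (\<Sum>\<^sub>\<infinity>i\<in>I. ennreal (f (r i))) = (\<Sum>\<^sub>\<infinity>i\<in>I'. ennreal (f (r' i))) \<and>
      (\<forall>i\<in>I'. 0 < r' i \<and> r' i \<le> \<rho>') \<and> F \<subseteq> (\<Union>i\<in>I'. ball (c' i) (r' i))"
    using assms by - (rule exI[of _ I], rule exI[of _ c], rule exI[of _ r], fastforce)
qed

text \<open>The limit defining the measure exists and is a supremum.\<close>

lemma hausdorff_premeasure_tendsto_SUP:
  "((\<lambda>\<rho>. hausdorff_premeasure f \<rho> F) \<longlongrightarrow> (SUP \<rho>\<in>{0<..}. hausdorff_premeasure f \<rho> F)) (at_right 0)"
proof (rule order_tendstoI)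
  fix a assume "a < (SUP \<rho>\<in>{0<..}. hausdorff_premeasure f \<rho> F)"
  then obtain \<rho>0 where "\<rho>0 > 0" and a: "a < hausdorff_premeasure f \<rho>0 F"
    by (auto simp: less_SUP_iff)
  have "\<forall>\<^sub>F \<rho> in at_right 0. \<rho> \<in> {0<..<\<rho>0}"
    using \<open>\<rho>0 > 0\<close> by (rule eventually_at_right_real)
  then show "\<forall>\<^sub>F \<rho> in at_right 0. a < hausdorff_premeasure f \<rho> F"
  proof eventually_elim
    case (elim \<rho>)
    then have "hausdorff_premeasure f \<rho>0 F \<le> hausdorff_premeasure f \<rho> F"
      by (intro hausdorff_premeasure_antimono) simp
    with a show ?case by (rule less_le_trans)
  qed
next
  fix a assume a: "(SUP \<rho>\<in>{0<..}. hausdorff_premeasure f \<rho> F) < a"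
  have "\<forall>\<^sub>F \<rho> in at_right (0::real). \<rho> \<in> {0<..<1}"
    by (rule eventually_at_right_real) simp
  then show "\<forall>\<^sub>F \<rho> in at_right 0. hausdorff_premeasure f \<rho> F < a"
  proof eventually_elim
    case (elim \<rho>)
    then have "hausdorff_premeasure f \<rho> F \<le> (SUP \<rho>\<in>{0<..}. hausdorff_premeasure f \<rho> F)"
      by (intro SUP_upper) auto
    with a show ?case by simp
  qed
qed

lemma hausdorff_measure_eq_SUP:
  "hausdorff_measure f F = (SUP \<rho>\<in>{0<..}. hausdorff_premeasure f \<rho> F)"
  unfolding hausdorff_measure_def
  by (rule tendsto_Lim[OF _ hausdorff_premeasure_tendsto_SUP]) simp

definition unit_circle :: "(real ^ 2) set" where
  "unit_circle = {x. (x $ 1)\<^sup>2 + (x $ 2)\<^sup>2 = 1}"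

text \<open>
  Triples \<open>(p1, p2, q)\<close> need not be primitive, and proportional triples are counted separately.
\<close>

definition circle_approximable :: "(real \<Rightarrow> real) \<Rightarrow> (real ^ 2) set" where
  "circle_approximable \<psi> =
     {x \<in> unit_circle.
        infinite {(p1 :: int, p2 :: int, q :: int). q \<noteq> 0 \<and>
          \<bar>x $ 1 - of_int p1 / of_int q\<bar> < \<psi> (of_int \<bar>q\<bar>) \<and>
          \<bar>x $ 2 - of_int p2 / of_int q\<bar> < \<psi> (of_int \<bar>q\<bar>)}}"

end

theory Submission
  imports Defs "HOL-Real_Asymp.Real_Asymp"
begin

text \<open>
  Since \<open>r\<^sup>2 * \<psi> r \<rightarrow> 0\<close>, every approximant of large denominator lies on the circle. Distinct rational
  points of denominator at most \<open>Q\<close> on the circle are \<open>1 / Q\<close>-separated, so there are \<open>O(Q)\<close> of them,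
  and the natural dyadic cover settles the convergence case by Cauchy condensation.

  In the divergence case the circle is parametrised by \<open>u \<mapsto> ((1 - u\<^sup>2) / (1 + u\<^sup>2), 2 u / (1 + u\<^sup>2))\<close>,
  which sends \<open>m / n\<close> to a point of denominator \<open>n\<^sup>2 + m\<^sup>2\<close>. If the measure were finite, there would be
  a cover by balls of radii \<open>s i\<close> with \<open>\<Sum>i. f (s i)\<close> finite and \<open>\<Sum>i. s i\<close> tiny. A descent yields nested
  intervals \<open>J\<close> around fractions such that the balls meeting \<open>J\<close> have total radius at most
  \<open>|J| / 2048\<close>; their common point is well approximable but lies in no ball. If the descent got
  stuck inside \<open>J\<close>, a positive proportion of the fractions at every level \<open>k\<close> would be surrounded by
  balls of total \<open>f\<close>-cost at least \<open>f (\<phi> k) / 1024\<close>, with disjoint families of balls for different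
  fractions, and \<open>\<Sum>k. 16 ^ k * f (\<phi> k) = \<infinity>\<close> would contradict the finite total cost.
\<close>

section \<open>Separation and Farey fractions\<close>

text \<open>Each half-open cell of length \<open>\<delta>\<close> holds at most one point of
  \<open>X\<close>, so the cell index \<open>g\<close> is injective.\<close>

lemma card_separated_le:
  fixes X :: "real set"
  assumes "\<delta> > 0" "a \<le> b" "X \<subseteq> {a..b}"
    and sep: "\<And>x y. x \<in> X \<Longrightarrow> y \<in> X \<Longrightarrow> x \<noteq> y \<Longrightarrow> \<delta> \<le> \<bar>x - y\<bar>"
  shows "finite X" "real (card X) \<le> (b - a) / \<delta> + 1"
proof -
  define g where "g x = nat \<lfloor>(x - a) / \<delta>\<rfloor>" for x
  have inj: "inj_on g X"
  proof (rule inj_onI, rule ccontr)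
    fix x y assume xy: "x \<in> X" "y \<in> X" "g x = g y" "x \<noteq> y"
    have "(x - a) / \<delta> \<ge> 0" "(y - a) / \<delta> \<ge> 0" using xy assms by auto
    then have "\<lfloor>(x - a) / \<delta>\<rfloor> = \<lfloor>(y - a) / \<delta>\<rfloor>"
      using xy(3) unfolding g_def by (simp add: eq_nat_nat_iff)
    then have "\<bar>(x - a) / \<delta> - (y - a) / \<delta>\<bar> < 1" by linarith
    then have "\<bar>x - y\<bar> / \<delta> < 1" using \<open>\<delta> > 0\<close> by (simp add: abs_divide diff_divide_distrib[symmetric])
    with sep[of x y] xy \<open>\<delta> > 0\<close> show False by simp
  qed
  have img: "g ` X \<subseteq> {..nat \<lfloor>(b - a) / \<delta>\<rfloor>}"
    using assms unfolding g_def by (auto intro!: nat_mono floor_mono divide_right_mono)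
  show fin: "finite X" using finite_imageD[OF finite_subset[OF img] inj] by simp
  have "card X \<le> nat \<lfloor>(b - a) / \<delta>\<rfloor> + 1"
    using card_mono[OF _ img] card_image[OF inj] by simp
  moreover have "(b - a) / \<delta> \<ge> 0" using assms by simp
  ultimately show "real (card X) \<le> (b - a) / \<delta> + 1" by linarith
qed

definition farey :: "nat \<Rightarrow> real set" where
  "farey Q = {real m / real n | m n. 0 < n \<and> n \<le> Q \<and> m \<le> n}"

lemma finite_farey: "finite (farey Q)"
proof -
  have "farey Q \<subseteq> (\<lambda>(m, n). real m / real n) ` ({..Q} \<times> {..Q})"
    unfolding farey_def by force
  then show ?thesis by (rule finite_subset) simp
qed

lemma farey_mono: "Q \<le> R \<Longrightarrow> farey Q \<subseteq> farey R"
  unfolding farey_def by fastforce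

text \<open>Distinct fractions with denominators \<open>n\<close> and \<open>n'\<close> differ by a
  nonzero integer over \<open>n * n'\<close>. Separate bounds \<open>Q\<close> and \<open>R\<close>
  allow comparison of fractions from different levels.\<close>

lemma farey_separated:
  assumes "x \<in> farey Q" "y \<in> farey R" "x \<noteq> y"
  shows "1 / (real Q * real R) \<le> \<bar>x - y\<bar>"
proof -
  obtain m n where x: "x = real m / real n" "0 < n" "n \<le> Q" using assms(1) unfolding farey_def by auto
  obtain m' n' where y: "y = real m' / real n'" "0 < n'" "n' \<le> R" using assms(2) unfolding farey_def by auto
  define d where "d = int m * int n' - int m' * int n"
  have diff: "x - y = of_int d / (real n * real n')"
    unfolding x(1) y(1) d_def using x(2) y(2) by (simp add: field_simps)
  have "d \<noteq> 0" using diff assms(3) by auto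
  then have d1: "1 \<le> \<bar>real_of_int d\<bar>" by linarith
  have "1 / (real Q * real R) \<le> 1 / (real n * real n')"
    using x y by (intro divide_left_mono mult_mono) auto
  also have "\<dots> \<le> \<bar>real_of_int d\<bar> / (real n * real n')"
    using d1 by (intro divide_right_mono) auto
  also have "\<dots> = \<bar>x - y\<bar>" unfolding diff by (simp add: abs_mult)
  finally show ?thesis .
qed

lemma interval_length_le_sum:
  fixes a b :: real
  assumes "finite X" and "{a..b} \<subseteq> (\<Union>x\<in>X. {c x - r x..c x + r x})" and r: "\<And>x. x \<in> X \<Longrightarrow> 0 \<le> r x"
  shows "b - a \<le> (\<Sum>x\<in>X. 2 * r x)"
proof -
  have "ennreal (b - a) \<le> emeasure lborel (\<Union>x\<in>X. {c x - r x..c x + r x})"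
  proof (cases "a \<le> b")
    case True
    then have "ennreal (b - a) = emeasure lborel {a..b}" by simp
    also have "\<dots> \<le> emeasure lborel (\<Union>x\<in>X. {c x - r x..c x + r x})"
      by (intro emeasure_mono assms) (auto intro!: sets.finite_UN assms)
    finally show ?thesis .
  qed (simp add: ennreal_neg)
  also have "\<dots> \<le> (\<Sum>x\<in>X. emeasure lborel {c x - r x..c x + r x})"
    by (intro emeasure_subadditive_finite assms) auto
  also have "\<dots> = (\<Sum>x\<in>X. ennreal (2 * r x))"
    using r by (intro sum.cong) auto
  also have "\<dots> = ennreal (\<Sum>x\<in>X. 2 * r x)"
    using r by (subst sum_ennreal) auto
  finally show ?thesis
    using r by (subst (asm) ennreal_le_iff) (auto intro!: sum_nonneg)
qed

lemma harm_le_ln: "0 < n \<Longrightarrow> harm n \<le> 1 + ln (real n)"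
proof (cases n)
  case (Suc m)
  have "harm (Suc m) - ln (real (Suc m)) \<le> harm (Suc 0) - ln (real (Suc 0))"
    using decseqD[OF decseq_harm_diff_ln, of 0 m] by simp
  then show ?thesis using Suc by (simp add: harm_def)
qed simp

lemma card_farey_diff_ge:
  fixes a b :: real
  assumes ab: "0 \<le> a" "a < b" "b \<le> 1" and "0 < q"
  shows "(real q)\<^sup>2 * (b - a) - 3 * real q * harm q - 1
           \<le> real (card ((farey (4 * q) - farey q) \<inter> {a..b}))"
proof -
  define \<rho> where "\<rho> = 1 / (4 * (real q)\<^sup>2)"
  define P where "P = (farey (4 * q) - farey q) \<inter> {a..b}"
  define S where "S n = {real m / real n | m. m \<le> n \<and> real m / real n \<in> {a - 1 / (4 * real q * real n)..b + 1 / (4 * real q * real n)}}" for n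
  \<comment> \<open>By Dirichlet's theorem, intervals of radius \<open>1 / (4 * q * n)\<close> around the fractions of denominator
    \<open>n \<le> q\<close> and of radius \<open>\<rho>\<close> around \<open>P\<close> cover almost all of \<open>{a..b}\<close>, and the former have total length
    about \<open>(b - a) / 2\<close>. The index \<open>0\<close> stands for \<open>P\<close>.\<close>
  define T where "T n = (if n = 0 then P else S n)" for n
  define r where "r n = (if n = 0 then \<rho> else 1 / (4 * real q * real n))" for n
  have q: "real q > 0" using \<open>0 < q\<close> by simp
  have r0: "0 \<le> r n" for n unfolding r_def \<rho>_def by simp
  have finP: "finite P" unfolding P_def using finite_farey by simp
  have S: "finite (S n)" "real (card (S n)) \<le> real n * (b - a) + 3" if "0 < n" for n
  proof -
    have sep: "1 / real n \<le> \<bar>x - y\<bar>" if xy: "x \<in> S n" "y \<in> S n" "x \<noteq> y" for x y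
    proof -
      obtain m m' where x: "x = real m / real n" and y: "y = real m' / real n"
        using xy unfolding S_def by auto
      have "\<bar>x - y\<bar> = \<bar>real m - real m'\<bar> / real n"
        unfolding x y by (simp add: diff_divide_distrib[symmetric])
      moreover have "m \<noteq> m'" using xy x y by auto
      then have "1 \<le> \<bar>real m - real m'\<bar>" by linarith
      ultimately show ?thesis by (simp add: divide_right_mono)
    qed
    have sub: "S n \<subseteq> {a - 1 / (4 * real q * real n)..b + 1 / (4 * real q * real n)}"
      unfolding S_def by auto
    have le: "a - 1 / (4 * real q * real n) \<le> b + 1 / (4 * real q * real n)"
    proof -
      have "0 \<le> 1 / (4 * real q * real n)" by simp
      with ab show ?thesis by linarith
    qed
    note * = card_separated_le[OF _ le sub sep]
    show "finite (S n)" using *(1) that by simp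
    have "(b + 1 / (4 * real q * real n) - (a - 1 / (4 * real q * real n))) / (1 / real n)
        = real n * (b - a) + 1 / (2 * real q)"
      using that q by (simp add: field_simps)
    also have "\<dots> \<le> real n * (b - a) + 1"
      using \<open>0 < q\<close> by (simp add: field_simps)
    finally show "real (card (S n)) \<le> real n * (b - a) + 3" using *(2) that by simp
  qed
  \<comment> \<open>Shrinking by \<open>\<rho>\<close> ensures that an approximant within
    \<open>\<rho>\<close> of \<open>x\<close> still lies in \<open>{a..b}\<close>, hence in
    \<open>P\<close>. For small denominators the sets \<open>S n\<close> are widened
    instead.\<close>
  have cover: "{a + \<rho>..b - \<rho>} \<subseteq> (\<Union>z\<in>Sigma {..q} T. {snd z - r (fst z)..snd z + r (fst z)})"
  proof
    fix x assume x: "x \<in> {a + \<rho>..b - \<rho>}"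
    have "\<rho> \<ge> 0" unfolding \<rho>_def by simp
    then have x01: "a \<le> x" "x \<le> b" "0 \<le> x" "x \<le> 1" using x ab by auto
    obtain h k where hk: "0 < k" "k \<le> int (4 * q)" "\<bar>of_int k * x - of_int h\<bar> < 1 / real (4 * q)"
      using Dirichlet_approx[of "4 * q" x] \<open>0 < q\<close> by (metis mult_pos_pos zero_less_numeral)
    have "1 / real (4 * q) \<le> 1" using \<open>0 < q\<close> by simp
    then have h1: "\<bar>of_int k * x - of_int h\<bar> < 1" using hk(3) by linarith
    have "0 \<le> of_int k * x" "of_int k * x \<le> of_int k"
      using hk(1) x01 by (auto simp: mult_left_le)
    \<comment> \<open>The approximant must lie in the unit interval to belong to
      \<open>farey (4 * q)\<close>.\<close>
    then have "of_int h > (- 1 :: real)" "of_int h < of_int k + (1::real)" using h1 by linarith+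
    then have h: "0 \<le> h" "h \<le> k" by linarith+
    define m n where "m = nat h" and "n = nat k"
    have mn: "0 < n" "n \<le> 4 * q" "m \<le> n" unfolding m_def n_def using hk h by auto
    have mn': "of_int h = real m" "of_int k = real n" unfolding m_def n_def using hk h by auto
    define y where "y = real m / real n"
    have "\<bar>x - y\<bar> = \<bar>real n * x - real m\<bar> / real n"
    proof -
      have "x - y = (real n * x - real m) / real n" unfolding y_def using mn by (simp add: field_simps)
      then show ?thesis by (simp add: abs_divide)
    qed
    then have dist: "\<bar>x - y\<bar> < 1 / (4 * real q * real n)"
      using divide_strict_right_mono[OF hk(3), of "real n"] mn unfolding mn' by simp
    have yF: "y \<in> farey (4 * q)" unfolding farey_def y_def using mn by auto
    show "x \<in> (\<Union>z\<in>Sigma {..q} T. {snd z - r (fst z)..snd z + r (fst z)})"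
    proof (cases "y \<in> farey q")
      case True
      then obtain m' n' where y': "y = real m' / real n'" "0 < n'" "n' \<le> q" "m' \<le> n'"
        unfolding farey_def by auto
      \<comment> \<open>The Dirichlet fraction need not be reduced: \<open>n\<close> may exceed
        \<open>q\<close> although \<open>y\<close> has a denominator at most \<open>q\<close>.
        Passing to the smaller denominator only enlarges the permitted radius.\<close>
      define n'' where "n'' = (if n \<le> q then n else n')"
      define m'' where "m'' = (if n \<le> q then m else m')"
      have y'': "y = real m'' / real n''" "0 < n''" "n'' \<le> q" "m'' \<le> n''" "n'' \<le> n"
        using y' mn unfolding n''_def m''_def y_def[symmetric] by (auto simp: y_def)
      have "1 / (4 * real q * real n) \<le> 1 / (4 * real q * real n'')"
        using y'' q by (intro divide_left_mono mult_left_mono) auto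
      then have d: "\<bar>x - y\<bar> \<le> 1 / (4 * real q * real n'')" using dist by linarith
      have "y \<in> S n''"
        unfolding S_def using y'' d x01 by (intro CollectI exI[of _ m'']) (auto simp del: of_nat_mult)
      then have "(n'', y) \<in> Sigma {..q} T" using y'' by (auto simp: T_def)
      moreover have "x \<in> {snd (n'', y) - r (fst (n'', y))..snd (n'', y) + r (fst (n'', y))}"
        using d y'' by (auto simp: r_def)
      ultimately show ?thesis by blast
    next
      case False
      then have "q < n" using mn by (auto simp: farey_def y_def not_less[symmetric])
      then have "1 / (4 * real q * real n) \<le> \<rho>"
        unfolding \<rho>_def power2_eq_square using q by (intro divide_left_mono) auto
      then have d: "\<bar>x - y\<bar> \<le> \<rho>" using dist by linarith
      then have "(0, y) \<in> Sigma {..q} T" using x yF False by (auto simp: T_def P_def)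
      moreover have "x \<in> {snd (0::nat, y) - r (fst (0::nat, y))..snd (0::nat, y) + r (fst (0::nat, y))}"
        using d by (auto simp: r_def)
      ultimately show ?thesis by blast
    qed
  qed
  have finT: "finite (T n)" for n using finP S by (auto simp: T_def)
  have "(b - \<rho>) - (a + \<rho>) \<le> (\<Sum>z\<in>Sigma {..q} T. 2 * r (fst z))"
    by (rule interval_length_le_sum[OF _ cover]) (auto simp: finT r0)
  also have "\<dots> = (\<Sum>n\<le>q. \<Sum>y\<in>T n. 2 * r n)"
    by (subst sum.Sigma) (auto simp: finT intro!: sum.cong)
  also have "\<dots> = (\<Sum>n\<le>q. real (card (T n)) * (2 * r n))" by simp
  also have "\<dots> = real (card P) * (2 * \<rho>) + (\<Sum>n=1..q. real (card (S n)) * (2 / (4 * real q * real n)))"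
    by (simp add: atMost_atLeast0 sum.atLeast_Suc_atMost T_def r_def)
  also have "(\<Sum>n=1..q. real (card (S n)) * (2 / (4 * real q * real n)))
      \<le> (\<Sum>n=1..q. (real n * (b - a) + 3) * (2 / (4 * real q * real n)))"
    using S(2) by (intro sum_mono mult_right_mono) auto
  also have "\<dots> = (\<Sum>n=1..q. (b - a) / (2 * real q) + (3 / (2 * real q)) * inverse (real n))"
    using q by (intro sum.cong) (auto simp: field_simps)
  also have "\<dots> = (b - a) / 2 + 3 / (2 * real q) * harm q"
    using q by (simp add: sum.distrib harm_def sum_distrib_left)
  finally have main: "b - a - 2 * \<rho> \<le> real (card P) * (2 * \<rho>) + ((b - a) / 2 + 3 / (2 * real q) * harm q)"
    by simp
  have rho: "2 * (real q)\<^sup>2 * \<rho> = 1 / 2" unfolding \<rho>_def using q by (simp add: field_simps)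
  \<comment> \<open>Multiplying by \<open>2 * q\<^sup>2\<close> gives each point of \<open>P\<close>
    weight 1. The half of \<open>{a..b}\<close> not accounted for by small denominators becomes the
    main term, and the constant 3 in the bound for \<open>S n\<close>, summed against
    \<open>1 / n\<close>, becomes the harmonic error.\<close>
  have "2 * (real q)\<^sup>2 * (b - a) - 2 * (2 * (real q)\<^sup>2 * \<rho>) = 2 * (real q)\<^sup>2 * (b - a - 2 * \<rho>)"
    by (simp add: algebra_simps)
  also have "\<dots> \<le> 2 * (real q)\<^sup>2 * (real (card P) * (2 * \<rho>) + ((b - a) / 2 + 3 / (2 * real q) * harm q))"
    by (rule mult_left_mono[OF main]) simp
  also have "\<dots> = 2 * (2 * (real q)\<^sup>2 * \<rho>) * real (card P) + (real q)\<^sup>2 * (b - a) + 3 * real q * harm q"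
    using q by (simp add: field_simps power2_eq_square)
  finally have "2 * (real q)\<^sup>2 * (b - a) - 1 \<le> real (card P) + (real q)\<^sup>2 * (b - a) + 3 * real q * harm q"
    unfolding rho by simp
  then show ?thesis unfolding P_def by (simp add: algebra_simps)
qed

text \<open>Level \<open>k\<close> collects the fractions whose reduced denominator lies in the
  block from \<open>4 ^ (k - 1)\<close> (exclusive) to \<open>4 ^ k\<close>. Level 0 is empty,
  because \<open>0 - 1 = 0\<close> on naturals. Powers of 4 make both the number of fractions and
  the denominators of their images on the circle of order \<open>16 ^ k\<close>.\<close>

definition farey_new :: "nat \<Rightarrow> real set" where
  "farey_new k = farey (4 ^ k) - farey (4 ^ (k - 1))"

text \<open>For \<open>q = 4 ^ k\<close> the main term of order \<open>q\<^sup>2\<close> dominates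
  the error of order \<open>q * ln q\<close>, so half of it survives. Written for level
  \<open>Suc k\<close>, that half is the fraction 1/32 of \<open>16 ^ Suc k\<close>.\<close>

lemma eventually_card_farey_new_ge:
  fixes a b :: real
  assumes ab: "0 \<le> a" "a < b" "b \<le> 1"
  shows "\<forall>\<^sub>F k in sequentially. 16 ^ k * (b - a) / 32 \<le> real (card (farey_new k \<inter> {a..b}))"
proof -
  define d where "d = b - a"
  have "d > 0" unfolding d_def using ab by simp
  then have "\<forall>\<^sub>F q in at_top. q\<^sup>2 * d / 2 \<le> q\<^sup>2 * d - 3 * q * (1 + ln q) - (1::real)"
    by real_asymp
  moreover have "filterlim (\<lambda>k. 4 ^ k :: real) at_top sequentially" by real_asymp
  ultimately have "\<forall>\<^sub>F k in sequentially. (4 ^ k)\<^sup>2 * d / 2 \<le> (4 ^ k)\<^sup>2 * d - 3 * 4 ^ k * (1 + ln (4 ^ k)) - (1::real)"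
    by (rule eventually_compose_filterlim)
  then have "\<forall>\<^sub>F k in sequentially. 16 ^ Suc k * (b - a) / 32 \<le> real (card (farey_new (Suc k) \<inter> {a..b}))"
  proof eventually_elim
    case (elim k)
    have "16 ^ Suc k * (b - a) / 32 = (4 ^ k)\<^sup>2 * d / 2"
      unfolding d_def by (simp add: power_mult_distrib power2_eq_square flip: power_mult_distrib)
    also have "\<dots> \<le> (real (4 ^ k))\<^sup>2 * d - 3 * real (4 ^ k) * harm (4 ^ k) - 1"
    proof -
      have "3 * 4 ^ k * harm (4 ^ k) \<le> 3 * 4 ^ k * (1 + ln (4 ^ k :: real))"
        using harm_le_ln[of "4 ^ k"] by (intro mult_left_mono) auto
      with elim have "(4 ^ k)\<^sup>2 * d / 2 \<le> (4 ^ k)\<^sup>2 * d - 3 * 4 ^ k * harm (4 ^ k) - (1::real)"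
        by linarith
      then show ?thesis by simp
    qed
    also have "\<dots> \<le> real (card ((farey (4 * 4 ^ k) - farey (4 ^ k)) \<inter> {a..b}))"
      unfolding d_def by (rule card_farey_diff_ge[OF ab]) simp
    finally show ?case by (simp add: farey_new_def)
  qed
  then show ?thesis by (subst (asm) eventually_sequentially_Suc)
qed

lemma finite_farey_new: "finite (farey_new k)"
  unfolding farey_new_def using finite_farey by simp

lemma farey_new_separated:
  assumes "x \<in> farey_new j" "y \<in> farey_new k" "x \<noteq> y"
  shows "1 / (4 ^ j * 4 ^ k) \<le> \<bar>x - y\<bar>"
  using farey_separated[of x "4 ^ j" y "4 ^ k"] assms by (simp add: farey_new_def)

lemma farey_new_disjoint:
  assumes "j < k"
  shows "farey_new j \<inter> farey_new k = {}"
proof -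
  have "j \<le> k - 1" using assms by simp
  then have "farey (4 ^ j) \<subseteq> farey (4 ^ (k - 1))" by (intro farey_mono power_increasing) auto
  then show ?thesis unfolding farey_new_def by auto
qed

section \<open>The descent\<close>

text \<open>More than \<open>B / t\<close> indices would already give a finite sum above
  \<open>B\<close>.\<close>

lemma finite_if_bounded_sums:
  fixes g :: "'a \<Rightarrow> real"
  assumes "t > 0" "\<And>i. i \<in> X \<Longrightarrow> t < g i"
    and bd: "\<And>A. finite A \<Longrightarrow> A \<subseteq> X \<Longrightarrow> sum g A \<le> B"
  shows "finite X"
proof (rule ccontr)
  assume "infinite X"
  then obtain A where A: "A \<subseteq> X" "finite A" "card A = Suc (nat \<lceil>B / t\<rceil>)"
    using infinite_arbitrarily_large by blast
  have "B / t < real (card A)" unfolding A by linarith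
  then have "B < real (card A) * t" using \<open>t > 0\<close> by (simp add: field_simps)
  also have "\<dots> = (\<Sum>i\<in>A. t)" by simp
  also have "\<dots> \<le> sum g A" using A assms(2) by (intro sum_mono) (auto intro: less_imp_le)
  also have "\<dots> \<le> B" using bd A by simp
  finally show False by simp
qed

lemma card_UN_le_sum:
  assumes "finite X" "\<And>x. x \<in> X \<Longrightarrow> finite (F x)" "K \<subseteq> (\<Union>x\<in>X. F x)"
    "\<And>x. x \<in> X \<Longrightarrow> real (card (F x)) \<le> h x"
  shows "real (card K) \<le> sum h X"
proof -
  have "card K \<le> card (\<Union>x\<in>X. F x)" using assms by (intro card_mono) auto
  also have "\<dots> \<le> (\<Sum>x\<in>X. card (F x))" by (rule card_UN_le[OF assms(1)])
  finally have "real (card K) \<le> (\<Sum>x\<in>X. real (card (F x)))"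
    by (metis of_nat_le_iff of_nat_sum)
  also have "\<dots> \<le> sum h X" by (intro sum_mono assms)
  finally show ?thesis .
qed

lemma card_farey_new_le:
  assumes "a \<le> b" "X \<subseteq> farey_new k" "X \<subseteq> {a..b}"
  shows "real (card X) \<le> (b - a) * 16 ^ k + 1"
proof -
  have "real (card X) \<le> (b - a) / (1 / (4 ^ k * 4 ^ k)) + 1"
  proof (rule card_separated_le(2)[OF _ assms(1,3)])
    show "1 / (4 ^ k * 4 ^ k) \<le> \<bar>x - y\<bar>" if "x \<in> X" "y \<in> X" "x \<noteq> y" for x y
      using farey_new_separated[of x k y k] that assms(2) by auto
  qed simp
  then show ?thesis by (simp flip: power_mult_distrib)
qed

text \<open>The hypothesis \<open>small\<close> bounds the radii of the balls meeting the current
  interval, while the conclusion bounds their \<open>f\<close>-cost near the next centre. If every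
  candidate centre were surrounded by expensive balls, disjointly chosen candidates on all levels
  would bound a divergent series by the total cost \<open>S\<close>.\<close>

lemma descent_step:
  fixes f :: "real \<Rightarrow> real" and \<phi> :: "nat \<Rightarrow> real" and u s :: "'a \<Rightarrow> real"
  assumes f_pos: "\<And>r. r > 0 \<Longrightarrow> f r > 0" and phi_pos: "\<And>k. \<phi> k > 0"
    and phi_sum: "summable (\<lambda>k. 16 ^ k * \<phi> k)"
    and div: "\<not> summable (\<lambda>k. 16 ^ k * f (\<phi> k))"
    and s_pos: "\<And>i. i \<in> I \<Longrightarrow> 0 < s i"
    and bounded: "\<And>A. finite A \<Longrightarrow> A \<subseteq> I \<Longrightarrow> (\<Sum>i\<in>A. f (s i)) \<le> S"
    and J: "0 \<le> z - w" "z + w \<le> 1" "0 < w"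
    and small: "\<And>A. finite A \<Longrightarrow> A \<subseteq> {i \<in> I. \<bar>u i - z\<bar> < s i + w} \<Longrightarrow> (\<Sum>i\<in>A. s i) \<le> w / 1024"
  obtains k y where "K \<le> k" "y \<in> farey_new k" "\<bar>y - z\<bar> \<le> w / 2" "\<phi> k \<le> w / 2"
    "\<And>A. finite A \<Longrightarrow> A \<subseteq> {i \<in> I. \<bar>u i - y\<bar> < s i + \<phi> k} \<Longrightarrow> (\<Sum>i\<in>A. f (s i)) \<le> f (\<phi> k) / 1024"
proof (rule ccontr)
  note found = that
  assume neg: "\<not> thesis"
  define P where "P k = farey_new k \<inter> {z - w / 2..z + w / 2}" for k
  define hit where "hit k y = {i \<in> I. \<bar>u i - y\<bar> < s i + \<phi> k}" for k y
  have lim: "(\<lambda>k. 16 ^ k * \<phi> k) \<longlonglongrightarrow> 0" by (rule summable_LIMSEQ_zero[OF phi_sum])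
  \<comment> \<open>The bound 1/4 makes \<open>\<phi> k\<close> at most a quarter of the spacing
    \<open>1 / 16 ^ k\<close> of level \<open>k\<close>; the bound \<open>w / 2\<close> keeps the
    new interval inside the old one.\<close>
  have "\<forall>\<^sub>F k in sequentially. 16 ^ k * \<phi> k < min (1/4) (w / 2)"
    by (rule order_tendstoD(2)[OF lim]) (use J in simp)
  moreover have "\<forall>\<^sub>F k in sequentially. 16 ^ k * ((z + w / 2) - (z - w / 2)) / 32 \<le> real (card (P k))"
    unfolding P_def by (rule eventually_card_farey_new_ge) (use J in auto)
  \<comment> \<open>This absorbs the summand 1 of \<open>card_farey_new_le\<close> when the points
    of \<open>P j\<close> are counted.\<close>
  moreover have "\<forall>\<^sub>F k in sequentially. 1 \<le> 16 ^ k * w"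
    using \<open>0 < w\<close> by real_asymp
  ultimately have "\<forall>\<^sub>F k in sequentially. 16 ^ k * \<phi> k < 1/4 \<and> 16 ^ k * \<phi> k < w / 2 \<and>
      16 ^ k * w / 32 \<le> real (card (P k)) \<and> 1 \<le> 16 ^ k * w"
    by eventually_elim auto
  then obtain K1 where K1: "\<And>k. K1 \<le> k \<Longrightarrow> 16 ^ k * \<phi> k < 1/4" "\<And>k. K1 \<le> k \<Longrightarrow> 16 ^ k * \<phi> k < w / 2"
    "\<And>k. K1 \<le> k \<Longrightarrow> 16 ^ k * w / 32 \<le> real (card (P k))" "\<And>k. K1 \<le> k \<Longrightarrow> 1 \<le> 16 ^ k * w"
    by (auto simp: eventually_sequentially)
  \<comment> \<open>As 1536 = 12 * 128, this tail bound leaves at most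
    \<open>16 ^ k * w / 128\<close> excluded points in \<open>card_excl\<close>.\<close>
  obtain K2 where K2: "\<And>m n. K2 \<le> m \<Longrightarrow> norm (\<Sum>k\<in>{m..<n}. 16 ^ k * \<phi> k) < 1 / 1536"
    using phi_sum[unfolded summable_Cauchy, rule_format, of "1 / 1536"] by auto
  define M where "M = max K (max K1 K2)"
  have phi_w: "\<phi> k \<le> w / 2" if "M \<le> k" for k
  proof -
    have "\<phi> k \<le> 16 ^ k * \<phi> k" using phi_pos[of k] by simp
    also have "\<dots> \<le> w / 2" using K1(2)[of k] that by (simp add: M_def)
    finally show ?thesis .
  qed
  have phi16: "\<phi> k \<le> 1 / 4 / 16 ^ k" if "M \<le> k" for k
    using K1(1)[of k] that by (simp add: M_def field_simps)
  have finP: "finite (P k)" for k unfolding P_def using finite_farey_new by simp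
  have P_dist: "\<bar>y - z\<bar> \<le> w / 2" if "y \<in> P k" for y k
  proof -
    have "z - w / 2 \<le> y" "y \<le> z + w / 2" using that unfolding P_def by auto
    then show ?thesis by linarith
  qed
  \<comment> \<open>Every point of \<open>P k\<close> with \<open>M \<le> k\<close> meets all
    demands on the new centre except the cost bound, so the cost bound must fail there.\<close>
  have "\<exists>A. finite A \<and> A \<subseteq> hit k y \<and> f (\<phi> k) / 1024 < (\<Sum>i\<in>A. f (s i))" if "M \<le> k" "y \<in> P k" for k y
  proof (rule ccontr)
    assume no: "\<not> ?thesis"
    have thesis
    proof (rule found[of k y])
      show "K \<le> k" "y \<in> farey_new k" "\<phi> k \<le> w / 2"
        using \<open>M \<le> k\<close> \<open>y \<in> P k\<close> phi_w by (auto simp: M_def P_def)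
      show "\<bar>y - z\<bar> \<le> w / 2" by (rule P_dist) fact
    qed (use no in \<open>auto simp: hit_def not_less\<close>)
    with neg show False by simp
  qed
  then have "\<forall>k y. \<exists>A. M \<le> k \<and> y \<in> P k \<longrightarrow> finite A \<and> A \<subseteq> hit k y \<and> f (\<phi> k) / 1024 < (\<Sum>i\<in>A. f (s i))"
    by blast
  then obtain A where A: "\<And>k y. M \<le> k \<Longrightarrow> y \<in> P k \<Longrightarrow> finite (A k y)"
    "\<And>k y. M \<le> k \<Longrightarrow> y \<in> P k \<Longrightarrow> A k y \<subseteq> hit k y"
    "\<And>k y. M \<le> k \<Longrightarrow> y \<in> P k \<Longrightarrow> f (\<phi> k) / 1024 < (\<Sum>i\<in>A k y. f (s i))"
    by metis
  \<comment> \<open>Discard the points met by a ball that is large on the scale \<open>1 / 16 ^ k\<close> of level \<open>k\<close>, and the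
    points too close to an earlier level. Around the remaining points the sets \<open>hit k y\<close> are pairwise
    disjoint over all levels, so the divergent sum over levels is bounded by \<open>S\<close>.\<close>
  define killed where "killed k = {y \<in> P k. \<exists>i\<in>hit k y. 1 / 4 / 16 ^ k < s i}" for k
  define excl where "excl k = {y \<in> P k. \<exists>j\<in>{M..<k}. \<exists>x\<in>P j. \<bar>x - y\<bar> \<le> 2 * \<phi> j}" for k
  define G where "G k = P k - killed k - excl k" for k
  have card_killed: "real (card (killed k)) \<le> 16 ^ k * w / 128" if k: "M \<le> k" for k
  proof -
    define F where "F = {i \<in> I. \<bar>u i - z\<bar> < s i + w \<and> 1 / 4 / 16 ^ k < s i}"
    have F_sum: "sum s B \<le> w / 1024" if "finite B" "B \<subseteq> F" for B
      using small[of B] that unfolding F_def by blast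
    have finF: "finite F"
      by (rule finite_if_bounded_sums[where t = "1 / 4 / 16 ^ k" and g = s, OF _ _ F_sum]) (auto simp: F_def)
    \<comment> \<open>A large ball kills only points within \<open>2 * s i\<close> of
      \<open>u i\<close>. There are at most \<open>4 * s i * 16 ^ k + 1\<close> of these, and
      \<open>1 < 4 * 16 ^ k * s i\<close> absorbs the last summand. All such balls meet the current
      interval, so \<open>small\<close> bounds the sum of their radii.\<close>
    have "real (card (killed k)) \<le> (\<Sum>i\<in>F. 8 * 16 ^ k * s i)"
    proof (rule card_UN_le_sum[OF finF, where F = "\<lambda>i. P k \<inter> {u i - 2 * s i..u i + 2 * s i}"])
      show "killed k \<subseteq> (\<Union>i\<in>F. P k \<inter> {u i - 2 * s i..u i + 2 * s i})"
      proof
        fix y assume "y \<in> killed k"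
        then obtain i where i: "y \<in> P k" "i \<in> I" "\<bar>u i - y\<bar> < s i + \<phi> k" "1 / 4 / 16 ^ k < s i"
          unfolding killed_def hit_def by auto
        have "\<bar>y - z\<bar> \<le> w / 2" by (rule P_dist[OF i(1)])
        then have "\<bar>u i - z\<bar> < s i + w" using i(3) phi_w[OF k] by linarith
        then have "i \<in> F" using i unfolding F_def by simp
        moreover have "\<bar>u i - y\<bar> \<le> 2 * s i" using i(3,4) phi16[OF k] by linarith
        then have "y \<in> {u i - 2 * s i..u i + 2 * s i}" by (simp add: abs_le_iff)
        ultimately show "y \<in> (\<Union>i\<in>F. P k \<inter> {u i - 2 * s i..u i + 2 * s i})" using i(1) by blast
      qed
      fix i assume "i \<in> F"
      then have s: "1 / 4 / 16 ^ k < s i" "0 < s i" using s_pos unfolding F_def by auto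
      have "real (card (P k \<inter> {u i - 2 * s i..u i + 2 * s i})) \<le> (u i + 2 * s i - (u i - 2 * s i)) * 16 ^ k + 1"
        by (rule card_farey_new_le) (use s in \<open>auto simp: P_def\<close>)
      also have "\<dots> \<le> 8 * 16 ^ k * s i" using s by (simp add: field_simps)
      finally show "real (card (P k \<inter> {u i - 2 * s i..u i + 2 * s i})) \<le> 8 * 16 ^ k * s i" .
    qed (simp add: finP)
    also have "\<dots> = 8 * 16 ^ k * sum s F" by (simp add: sum_distrib_left)
    also have "\<dots> \<le> 8 * 16 ^ k * (w / 1024)" using F_sum[OF finF] by (intro mult_left_mono) auto
    finally show ?thesis by (simp add: mult_ac)
  qed
  have card_excl: "real (card (excl k)) \<le> 16 ^ k * w / 128" if k: "M \<le> k" for k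
  proof -
    define C where "C j x = {y \<in> P k. \<bar>x - y\<bar> \<le> 2 * \<phi> j}" for j x
    have finC: "finite (C j x)" for j x unfolding C_def using finP by simp
    \<comment> \<open>A summand 1 for every earlier point \<open>x\<close> would be too much. If
      \<open>C j x\<close> is nonempty, however, separation across the two levels forces
      \<open>1 \<le> 2 * \<phi> j * 16 ^ k\<close>, so the count is proportional to
      \<open>\<phi> j\<close>.\<close>
    have C: "real (card (C j x)) \<le> 6 * \<phi> j * 16 ^ k" if j: "M \<le> j" "j < k" "x \<in> P j" for j x
    proof (cases "C j x = {}")
      case False
      then obtain y where y: "y \<in> P k" "\<bar>x - y\<bar> \<le> 2 * \<phi> j" unfolding C_def by auto
      have "x \<noteq> y" using farey_new_disjoint[OF \<open>j < k\<close>] y(1) \<open>x \<in> P j\<close> unfolding P_def by auto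
      then have "1 / (4 ^ j * 4 ^ k) \<le> \<bar>x - y\<bar>"
        using farey_new_separated[of x j y k] y(1) \<open>x \<in> P j\<close> unfolding P_def by auto
      with y(2) have *: "1 / (4 ^ j * 4 ^ k) \<le> 2 * \<phi> j" by linarith
      have "1 \<le> (4::real) ^ k / 4 ^ j" using j(2) by (simp add: field_simps)
      also have "\<dots> = 16 ^ k * (1 / (4 ^ j * 4 ^ k))"
        by (simp add: field_simps flip: power_mult_distrib)
      also have "\<dots> \<le> 16 ^ k * (2 * \<phi> j)" by (rule mult_left_mono[OF *]) simp
      finally have one: "1 \<le> 2 * \<phi> j * 16 ^ k" by (simp add: mult.commute)
      have "real (card (C j x)) \<le> ((x + 2 * \<phi> j) - (x - 2 * \<phi> j)) * 16 ^ k + 1"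
      proof (rule card_farey_new_le)
        show "C j x \<subseteq> {x - 2 * \<phi> j..x + 2 * \<phi> j}" unfolding C_def by (auto simp: abs_le_iff)
      qed (use phi_pos[of j] in \<open>auto simp: C_def P_def\<close>)
      also have "\<dots> \<le> 6 * \<phi> j * 16 ^ k" using one by (simp add: algebra_simps)
      finally show ?thesis .
    qed (use phi_pos[of j] in simp)
    have "real (card (excl k)) \<le> (\<Sum>j\<in>{M..<k}. 12 * w * 16 ^ k * (16 ^ j * \<phi> j))"
    proof (rule card_UN_le_sum[where F = "\<lambda>j. \<Union>x\<in>P j. C j x"])
      fix j assume j: "j \<in> {M..<k}"
      have "real (card (\<Union>x\<in>P j. C j x)) \<le> (\<Sum>x\<in>P j. 6 * \<phi> j * 16 ^ k)"
        by (rule card_UN_le_sum[OF finP, where F = "C j"]) (use C j finC in auto)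
      also have "\<dots> = real (card (P j)) * (6 * \<phi> j * 16 ^ k)" by simp
      also have "\<dots> \<le> (2 * (16 ^ j * w)) * (6 * \<phi> j * 16 ^ k)"
      proof (intro mult_right_mono)
        have "real (card (P j)) \<le> (z + w / 2 - (z - w / 2)) * 16 ^ j + 1"
          by (rule card_farey_new_le) (use J in \<open>auto simp: P_def\<close>)
        also have "\<dots> \<le> 2 * (16 ^ j * w)"
          using K1(4)[of j] j by (simp add: M_def mult.commute)
        finally show "real (card (P j)) \<le> 2 * (16 ^ j * w)" .
      qed (use phi_pos[of j] in simp)
      finally show "real (card (\<Union>x\<in>P j. C j x)) \<le> 12 * w * 16 ^ k * (16 ^ j * \<phi> j)"
        by (simp add: mult_ac)
    qed (auto simp: excl_def C_def finP)
    also have "\<dots> = 12 * w * 16 ^ k * (\<Sum>j\<in>{M..<k}. 16 ^ j * \<phi> j)" by (simp add: sum_distrib_left)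
    also have "\<dots> \<le> 12 * w * 16 ^ k * (1 / 1536)"
    proof (intro mult_left_mono)
      have "norm (\<Sum>j\<in>{M..<k}. 16 ^ j * \<phi> j) < 1 / 1536" by (rule K2) (simp add: M_def)
      then show "(\<Sum>j\<in>{M..<k}. 16 ^ j * \<phi> j) \<le> 1 / 1536"
        unfolding real_norm_def by linarith
    qed (use J in auto)
    finally show ?thesis by (simp add: mult_ac)
  qed
  \<comment> \<open>Of the proportion 1/32 available, 1/128 is killed and 1/128 is excluded.\<close>
  have card_G: "16 ^ k * w / 64 \<le> real (card (G k))" if k: "M \<le> k" for k
  proof -
    have "P k = G k \<union> killed k \<union> excl k" unfolding G_def killed_def excl_def by auto
    then have "card (P k) \<le> card (G k) + card (killed k) + card (excl k)"
      by (metis card_Un_le add_le_mono1 le_trans)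
    then have "real (card (P k)) \<le> real (card (G k)) + real (card (killed k)) + real (card (excl k))"
      by linarith
    then show ?thesis using card_killed[OF k] card_excl[OF k] K1(3)[of k] k by (simp add: M_def)
  qed
  have small_hit: "s i \<le> 1 / 4 / 16 ^ k" if "y \<in> G k" "i \<in> hit k y" for i k y
    using that unfolding G_def killed_def by (auto simp: not_less[symmetric])
  have disj_lt: "hit j x \<inter> hit k y = {}" if jk: "M \<le> j" "j \<le> k" "x \<in> G j" "y \<in> G k" "x \<noteq> y" for j k x y
  proof (rule ccontr)
    assume "hit j x \<inter> hit k y \<noteq> {}"
    then obtain i where i: "i \<in> hit j x" "i \<in> hit k y" by auto
    \<comment> \<open>A shared ball links the two points. Its radius and \<open>\<phi> k\<close> are
      each at most a quarter of the spacing of the finer level \<open>k\<close>, which leaves three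
      quarters of that spacing plus \<open>\<phi> j\<close>.\<close>
    have "\<bar>x - y\<bar> < 2 * s i + \<phi> j + \<phi> k" using i unfolding hit_def by auto
    moreover note small_hit[OF jk(4) i(2)] phi16[of k]
    ultimately have up: "\<bar>x - y\<bar> < 3 * (1 / 4 / 16 ^ k) + \<phi> j" using jk by linarith
    have low: "1 / (4 ^ j * 4 ^ k) \<le> \<bar>x - y\<bar>"
      using farey_new_separated[of x j y k] jk unfolding G_def P_def by auto
    show False
    proof (cases "j = k")
      case True
      have "1 / (4 ^ j * 4 ^ k) = 4 * (1 / 4 / 16 ^ k :: real)"
        using True by (simp flip: power_mult_distrib)
      moreover have "\<phi> j \<le> 1 / 4 / 16 ^ k" using phi16[OF jk(1)] True by simp
      ultimately show False using up low by linarith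
    next
      case False
      then have "j < k" using jk by simp
      \<comment> \<open>As \<open>y\<close> is not excluded, \<open>\<phi> j\<close> is less than
        half the distance, so the distance is below \<open>3 / 2 / 16 ^ k\<close>. Levels
        \<open>j < k\<close> are separated by at least \<open>4 / 16 ^ k\<close>.\<close>
      then have "\<bar>x - y\<bar> > 2 * \<phi> j" using jk unfolding G_def excl_def by (auto simp: not_le)
      moreover have "1 / 16 ^ k \<le> 1 / (4 ^ j * 4 ^ k :: real)"
      proof -
        have "(4::real) ^ j * 4 ^ k \<le> 4 ^ k * 4 ^ k"
          using jk by (intro mult_right_mono power_increasing) auto
        also have "\<dots> = 16 ^ k" by (simp flip: power_mult_distrib)
        finally show ?thesis by (intro divide_left_mono) auto
      qed
      moreover have "4 * (1 / 16 ^ k) \<le> 1 / (4 ^ j * 4 ^ k :: real)"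
      proof -
        have "(4::real) ^ Suc j * 4 ^ k \<le> 4 ^ k * 4 ^ k"
          using \<open>j < k\<close> by (intro mult_right_mono power_increasing) auto
        also have "\<dots> = 16 ^ k" by (simp flip: power_mult_distrib)
        finally have "1 / 16 ^ k \<le> 1 / (4 ^ Suc j * 4 ^ k :: real)" by (intro divide_left_mono) auto
        then show ?thesis by simp
      qed
      ultimately show False using up low by simp
    qed
  qed
  have disj: "hit (fst p) (snd p) \<inter> hit (fst p') (snd p') = {}"
    if "p \<in> Sigma {M..<N} G" "p' \<in> Sigma {M..<N} G" "p \<noteq> p'" for p p' N
  proof -
    obtain j x k y where p: "p = (j, x)" "p' = (k, y)" by (cases p, cases p')
    have xy: "x \<noteq> y"
    proof
      assume "x = y"
      then have "j \<noteq> k" using that p by auto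
      then have "farey_new j \<inter> farey_new k = {}"
        using farey_new_disjoint[of j k] farey_new_disjoint[of k j] by (auto simp: neq_iff)
      then show False using that p \<open>x = y\<close> by (auto simp: G_def P_def)
    qed
    show ?thesis
      using disj_lt[of j k x y] disj_lt[of k j y x] xy that p by (cases "j \<le> k") auto
  qed
  have bd: "(\<Sum>k\<in>{M..<N}. 16 ^ k * f (\<phi> k)) \<le> 65536 / w * S" for N
  proof -
    define D where "D = Sigma {M..<N} G"
    have finG: "finite (G k)" for k unfolding G_def using finP by simp
    have finD: "finite D" unfolding D_def using finG by auto
    have D: "M \<le> fst p" "snd p \<in> P (fst p)" if "p \<in> D" for p
      using that unfolding D_def G_def by auto
    \<comment> \<open>Here 65536 = 64 * 1024: one factor comes from the count of \<open>G k\<close>,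
      the other from the cost around each point.\<close>
    have "(\<Sum>k\<in>{M..<N}. 16 ^ k * f (\<phi> k)) * (w / 65536) = (\<Sum>k\<in>{M..<N}. 16 ^ k * w / 64 * (f (\<phi> k) / 1024))"
      unfolding sum_distrib_right by (intro sum.cong) auto
    also have "\<dots> \<le> (\<Sum>k\<in>{M..<N}. real (card (G k)) * (f (\<phi> k) / 1024))"
      using card_G f_pos[OF phi_pos] by (intro sum_mono mult_right_mono) (auto intro: less_imp_le)
    also have "\<dots> = (\<Sum>k\<in>{M..<N}. \<Sum>y\<in>G k. f (\<phi> k) / 1024)" by simp
    also have "\<dots> = (\<Sum>p\<in>D. f (\<phi> (fst p)) / 1024)"
      unfolding D_def by (subst sum.Sigma) (auto simp: finG intro!: sum.cong)
    also have "\<dots> \<le> (\<Sum>p\<in>D. \<Sum>i\<in>A (fst p) (snd p). f (s i))"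
      using A(3) D by (intro sum_mono less_imp_le) auto
    also have "\<dots> = (\<Sum>i\<in>(\<Union>p\<in>D. A (fst p) (snd p)). f (s i))"
    proof (rule sum.UNION_disjoint[symmetric, OF finD])
      show "\<forall>p\<in>D. finite (A (fst p) (snd p))" using A(1) D by blast
      show "\<forall>p\<in>D. \<forall>p'\<in>D. p \<noteq> p' \<longrightarrow> A (fst p) (snd p) \<inter> A (fst p') (snd p') = {}"
      proof (intro ballI impI)
        fix p p' assume p: "p \<in> D" "p' \<in> D" "p \<noteq> p'"
        have "hit (fst p) (snd p) \<inter> hit (fst p') (snd p') = {}"
          using disj[of p N p'] p unfolding D_def by simp
        moreover have "A (fst p) (snd p) \<subseteq> hit (fst p) (snd p)" by (rule A(2)[OF D[OF p(1)]])
        moreover have "A (fst p') (snd p') \<subseteq> hit (fst p') (snd p')" by (rule A(2)[OF D[OF p(2)]])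
        ultimately show "A (fst p) (snd p) \<inter> A (fst p') (snd p') = {}" by blast
      qed
    qed
    also have "\<dots> \<le> S"
    proof (rule bounded)
      show "finite (\<Union>p\<in>D. A (fst p) (snd p))" using finD A(1) D by blast
      show "(\<Union>p\<in>D. A (fst p) (snd p)) \<subseteq> I"
      proof (rule UN_least)
        fix p assume p: "p \<in> D"
        show "A (fst p) (snd p) \<subseteq> I" using A(2)[OF D[OF p]] unfolding hit_def by blast
      qed
    qed
    finally show ?thesis using J by (simp add: field_simps)
  qed
  have "summable (\<lambda>k. 16 ^ (k + M) * f (\<phi> (k + M)))"
  proof (rule summableI_nonneg_bounded)
    show "0 \<le> 16 ^ (n + M) * f (\<phi> (n + M))" for n using f_pos[OF phi_pos] by (simp add: less_imp_le)
    show "(\<Sum>k<n. 16 ^ (k + M) * f (\<phi> (k + M))) \<le> 65536 / w * S" for n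
      using bd[of "n + M"] sum.shift_bounds_nat_ivl[of "\<lambda>k. 16 ^ k * f (\<phi> k)" 0 M n]
      by (simp add: atLeast0LessThan)
  qed
  then have "summable (\<lambda>k. 16 ^ k * f (\<phi> k))"
    by (subst (asm) summable_iff_shift[of "\<lambda>k. 16 ^ k * f (\<phi> k)"])
  with div show False by simp
qed

lemma antimono_ratioD:
  fixes f :: "real \<Rightarrow> real"
  assumes "antimono_on {0<..} (\<lambda>r. f r / r)" "0 < x" "x \<le> y"
  shows "f y / y \<le> f x / x"
  using monotone_onD[OF assms(1), of x y] assms by simp

text \<open>Iterated descent gives nested intervals with centres on increasing levels
  \<open>k\<close> and half-widths \<open>\<phi> k\<close>. Their common point \<open>v\<close> is
  within \<open>\<phi> k\<close> of each centre, while a ball containing \<open>v\<close> would have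
  to be smaller than every half-width, and these tend to 0.\<close>

lemma exists_uncovered_point:
  fixes f :: "real \<Rightarrow> real" and \<phi> :: "nat \<Rightarrow> real" and u s :: "'a \<Rightarrow> real"
  assumes f_pos: "\<And>r. r > 0 \<Longrightarrow> f r > 0" and f_mono: "mono_on {0<..} f"
    and f_ratio: "antimono_on {0<..} (\<lambda>r. f r / r)"
    and phi_pos: "\<And>k. \<phi> k > 0"
    and phi_sum: "summable (\<lambda>k. 16 ^ k * \<phi> k)"
    and div: "\<not> summable (\<lambda>k. 16 ^ k * f (\<phi> k))"
    and s_pos: "\<And>i. i \<in> I \<Longrightarrow> 0 < s i"
    and bounded: "\<And>A. finite A \<Longrightarrow> A \<subseteq> I \<Longrightarrow> (\<Sum>i\<in>A. f (s i)) \<le> S"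
    and small: "\<And>A. finite A \<Longrightarrow> A \<subseteq> I \<Longrightarrow> (\<Sum>i\<in>A. s i) \<le> 1 / 2048"
  obtains v where "0 \<le> v" "v \<le> 1" "\<And>i. i \<in> I \<Longrightarrow> s i \<le> \<bar>v - u i\<bar>"
    "infinite {k. \<exists>y\<in>farey_new k. \<bar>v - y\<bar> \<le> \<phi> k}"
proof -
  define hit where "hit z w = {i \<in> I. \<bar>u i - z\<bar> < s i + w}" for z w
  define good where "good z w \<longleftrightarrow> 0 \<le> z - w \<and> z + w \<le> 1 \<and> 0 < w \<and>
    (\<forall>A. finite A \<and> A \<subseteq> hit z w \<longrightarrow> (\<Sum>i\<in>A. s i) \<le> w / 1024)" for z w
  have good_less: "s i < w" if "good z w" "i \<in> hit z w" for z w i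
  proof -
    have "finite {i} \<and> {i} \<subseteq> hit z w" using that by simp
    then have "sum s {i} \<le> w / 1024" "0 < w" using that(1) unfolding good_def by blast+
    then show ?thesis by simp
  qed
  have step: "\<exists>k' y. k < k' \<and> y \<in> farey_new k' \<and> \<bar>y - z\<bar> \<le> w / 2 \<and> \<phi> k' \<le> w / 2 \<and> good y (\<phi> k')"
    if "good z w" for k z w
  proof -
    have J: "0 \<le> z - w" "z + w \<le> 1" "0 < w" using that unfolding good_def by auto
    have sm: "(\<Sum>i\<in>A. s i) \<le> w / 1024" if "finite A" "A \<subseteq> {i \<in> I. \<bar>u i - z\<bar> < s i + w}" for A
      using \<open>good z w\<close> that unfolding good_def hit_def by blast
    obtain k' y where k': "Suc k \<le> k'" "y \<in> farey_new k'" "\<bar>y - z\<bar> \<le> w / 2" "\<phi> k' \<le> w / 2"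
      and le: "\<And>A. finite A \<Longrightarrow> A \<subseteq> hit y (\<phi> k') \<Longrightarrow> (\<Sum>i\<in>A. f (s i)) \<le> f (\<phi> k') / 1024"
      using descent_step[OF f_pos phi_pos phi_sum div s_pos bounded J sm, where K = "Suc k"]
      unfolding hit_def by blast
    define p where "p = \<phi> k'"
    have p: "p > 0" "f p > 0" unfolding p_def using phi_pos f_pos by auto
    \<comment> \<open>This turns cost back into length. A ball cheaper than \<open>f p\<close> has
      radius below \<open>p\<close> by monotonicity of \<open>f\<close>, and at smaller radii
      \<open>f\<close> costs at least as much per unit length.\<close>
    have s_le: "s i \<le> p / f p * f (s i)" if "i \<in> hit y p" for i
    proof -
      have i: "i \<in> I" "0 < s i" using that s_pos unfolding hit_def by auto
      have "f (s i) \<le> f p / 1024" using le[of "{i}"] that by (simp add: p_def)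
      then have "f (s i) < f p" using p by simp
      then have "s i < p" using monotone_onD[OF f_mono, of p "s i"] p i by (meson greaterThan_iff not_le)
      then have "f p / p \<le> f (s i) / s i" by (intro antimono_ratioD[OF f_ratio]) (use i in auto)
      then show ?thesis using p i by (simp add: field_simps)
    qed
    have "good y p"
      unfolding good_def
    proof (intro conjI allI impI)
      show "0 \<le> y - p" "y + p \<le> 1" using k'(3,4) J unfolding p_def by linarith+
      fix A assume A: "finite A \<and> A \<subseteq> hit y p"
      then have "(\<Sum>i\<in>A. s i) \<le> (\<Sum>i\<in>A. p / f p * f (s i))" by (intro sum_mono s_le) auto
      also have "\<dots> = p / f p * (\<Sum>i\<in>A. f (s i))" by (simp add: sum_distrib_left)
      also have "\<dots> \<le> p / f p * (f p / 1024)" using le[of A] A p unfolding p_def by (intro mult_left_mono) auto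
      finally show "(\<Sum>i\<in>A. s i) \<le> p / 1024" using p by simp
    qed (rule p)
    then show ?thesis using k' unfolding p_def by (intro exI[of _ k'] exI[of _ y]) auto
  qed
  define R where "R t t' \<longleftrightarrow> (case t of (k, z, w) \<Rightarrow> case t' of (k', y, w') \<Rightarrow>
     k < k' \<and> y \<in> farey_new k' \<and> w' = \<phi> k' \<and> \<bar>y - z\<bar> \<le> w / 2 \<and> w' \<le> w / 2)" for t t' :: "nat \<times> real \<times> real"
  have "\<exists>g :: nat \<Rightarrow> nat \<times> real \<times> real. g 0 = (0, 1/2, 1/2) \<and>
     (\<forall>n. case g n of (k, z, w) \<Rightarrow> good z w) \<and> (\<forall>n. R (g n) (g (Suc n)))"
  proof -
    \<comment> \<open>For the unit interval \<open>w / 1024\<close> is 1/2048, the bound in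
      \<open>small\<close>.\<close>
    have start: "good (1/2) (1/2)" unfolding good_def
    proof (intro conjI allI impI)
      fix A assume "finite A \<and> A \<subseteq> hit (1/2) (1/2)"
      then show "(\<Sum>i\<in>A. s i) \<le> 1 / 2 / 1024" using small[of A] unfolding hit_def by auto
    qed auto
    have next_step: "\<exists>t'. (case t' of (k, z, w) \<Rightarrow> good z w) \<and> R t t'" if gt: "case t of (k, z, w) \<Rightarrow> good z w" for t
    proof -
      obtain k z w where t: "t = (k, z, w)" by (cases t) auto
      obtain k' y where "k < k'" "y \<in> farey_new k'" "\<bar>y - z\<bar> \<le> w / 2" "\<phi> k' \<le> w / 2" "good y (\<phi> k')"
        using step[of z w k] gt t by auto
      then show ?thesis by (intro exI[of _ "(k', y, \<phi> k')"]) (simp add: R_def t)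
    qed
    \<comment> \<open>The clause for \<open>n = 0\<close> pins the first state, which dependent
      choice would otherwise leave open.\<close>
    define Q where "Q n t \<longleftrightarrow> (case t of (k, z, w) \<Rightarrow> good z w) \<and> (n = 0 \<longrightarrow> t = (0, 1/2, 1/2))" for n :: nat and t :: "nat \<times> real \<times> real"
    have "Q 0 (0, 1/2, 1/2)" using start unfolding Q_def by simp
    then have "\<exists>t. Q 0 t" by (rule exI)
    moreover have "\<exists>t'. Q (Suc n) t' \<and> R t t'" if "Q n t" for n t
      using next_step[of t] that unfolding Q_def by simp
    ultimately have "\<exists>g. \<forall>n. Q n (g n) \<and> R (g n) (g (Suc n))"
      by (rule dependent_nat_choice)
    then obtain g where g: "\<forall>n. Q n (g n) \<and> R (g n) (g (Suc n))" by (rule exE)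
    have "g 0 = (0, 1/2, 1/2)" using g[rule_format, of 0] unfolding Q_def by simp
    moreover have "\<forall>n. case g n of (k, z, w) \<Rightarrow> good z w" using g unfolding Q_def by simp
    moreover have "\<forall>n. R (g n) (g (Suc n))" using g by simp
    ultimately show ?thesis by (intro exI conjI)
  qed
  then obtain g where g0: "g 0 = (0, 1/2, 1/2)"
    and gg: "\<And>n. case g n of (k, z, w) \<Rightarrow> good z w" and gR: "\<And>n. R (g n) (g (Suc n))" by (elim exE conjE) simp
  define k z w where "k n = fst (g n)" and "z n = fst (snd (g n))" and "w n = snd (snd (g n))" for n
  have g: "g n = (k n, z n, w n)" for n unfolding k_def z_def w_def by simp
  have good: "good (z n) (w n)" for n using gg[of n] g by simp
  have R: "k n < k (Suc n)" "z (Suc n) \<in> farey_new (k (Suc n))" "w (Suc n) = \<phi> (k (Suc n))"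
      "\<bar>z (Suc n) - z n\<bar> \<le> w n / 2" "w (Suc n) \<le> w n / 2" for n
    using gR[of n] g by (auto simp: R_def)
  define C where "C n = {z n - w n..z n + w n}" for n
  have sub: "C (Suc n) \<subseteq> C n" for n
  proof -
    have "z n - w n \<le> z (Suc n) - w (Suc n)" "z (Suc n) + w (Suc n) \<le> z n + w n"
      using R(4,5)[of n] by linarith+
    then show ?thesis unfolding C_def by simp
  qed
  have "decseq C" using sub by (rule decseq_SucI)
  have ne: "C n \<noteq> {}" for n using good[of n] unfolding C_def good_def by auto
  obtain v where v: "\<And>n. v \<in> C n"
  proof -
    have "\<Inter> (range C) \<noteq> {}"
      by (rule compact_nest[of C]) (use ne decseqD[OF \<open>decseq C\<close>] in \<open>auto simp: C_def\<close>)
    then show ?thesis using that by blast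
  qed
  have v_dist: "\<bar>v - z n\<bar> \<le> w n" for n
  proof -
    have "z n - w n \<le> v" "v \<le> z n + w n" using v[of n] unfolding C_def by auto
    then show ?thesis by linarith
  qed
  have w_le: "w n \<le> (1 / 2) ^ Suc n" for n
  proof (induction n)
    case 0 then show ?case using g0 g[of 0] by simp
  next
    case (Suc n) then show ?case using R(5)[of n] by simp
  qed
  have "(\<lambda>n. (1 / 2 :: real) ^ Suc n) \<longlonglongrightarrow> 0"
    by (rule LIMSEQ_Suc) (rule LIMSEQ_power_zero, simp)
  then have w_lim: "\<forall>\<^sub>F n in sequentially. (1 / 2) ^ Suc n < e" if "e > 0" for e :: real
    using that by (rule order_tendstoD(2))
  show thesis
  proof (rule that[of v])
    show "0 \<le> v" "v \<le> 1" using v[of 0] g[of 0] g0 unfolding C_def by auto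
    show "s i \<le> \<bar>v - u i\<bar>" if i: "i \<in> I" for i
    proof (rule ccontr)
      assume "\<not> ?thesis"
      then have lt: "\<bar>v - u i\<bar> < s i" by simp
      obtain n where n: "(1 / 2) ^ Suc n < s i"
        using eventually_happens[OF w_lim[OF s_pos[OF i]]] by auto
      have "i \<in> hit (z n) (w n)" using lt v_dist[of n] i unfolding hit_def by auto
      then have "s i < w n" by (rule good_less[OF good])
      then show False using n w_le[of n] by linarith
    qed
    have sm: "strict_mono (\<lambda>n. k (Suc n))" using R(1) by (simp add: strict_mono_Suc_iff)
    have "range (\<lambda>n. k (Suc n)) \<subseteq> {k. \<exists>y\<in>farey_new k. \<bar>v - y\<bar> \<le> \<phi> k}"
    proof (clarsimp)
      fix n
      show "\<exists>y\<in>farey_new (k (Suc n)). \<bar>v - y\<bar> \<le> \<phi> (k (Suc n))"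
        using R(2)[of n] v_dist[of "Suc n"] unfolding R(3)[symmetric] by blast
    qed
    moreover have "infinite (range (\<lambda>n. k (Suc n)))"
      using strict_mono_imp_inj_on[OF sm] by (simp add: finite_image_iff)
    ultimately show "infinite {k. \<exists>y\<in>farey_new k. \<bar>v - y\<bar> \<le> \<phi> k}"
      using infinite_super by blast
  qed
qed

section \<open>The circle and its rational points\<close>

lemma dist_vec2_sq:
  fixes x y :: "real ^ 2"
  shows "(dist x y)\<^sup>2 = (x $ 1 - y $ 1)\<^sup>2 + (x $ 2 - y $ 2)\<^sup>2"
  unfolding dist_vec_def L2_set_def by (simp add: sum_2 dist_real_def)

text \<open>This is inverse stereographic projection from the point (-1, 0), with \<open>u\<close>
  the slope of the line through that point.\<close>

definition stereo :: "real \<Rightarrow> real ^ 2" where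
  "stereo u = vector [(1 - u\<^sup>2) / (1 + u\<^sup>2), 2 * u / (1 + u\<^sup>2)]"

lemma stereo_nth [simp]:
  "stereo u $ 1 = (1 - u\<^sup>2) / (1 + u\<^sup>2)" "stereo u $ 2 = 2 * u / (1 + u\<^sup>2)"
  unfolding stereo_def by (simp_all add: vector_2)

lemma one_plus_square_neq_0: "1 + (u::real)\<^sup>2 \<noteq> 0"
  using zero_le_power2[of u] by linarith

lemma stereo_in_circle: "stereo u \<in> unit_circle"
proof -
  have "((1 - u\<^sup>2) / (1 + u\<^sup>2))\<^sup>2 + (2 * u / (1 + u\<^sup>2))\<^sup>2 = ((1 - u\<^sup>2)\<^sup>2 + (2 * u)\<^sup>2) / (1 + u\<^sup>2)\<^sup>2"
    by (simp add: power_divide add_divide_distrib)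
  also have "(1 - u\<^sup>2)\<^sup>2 + (2 * u)\<^sup>2 = (1 + u\<^sup>2)\<^sup>2" by algebra
  finally show ?thesis unfolding unit_circle_def using one_plus_square_neq_0[of u] by simp
qed

text \<open>The denominator is at least 1, and at most 4 when both parameters lie in
  \<open>{-1..1}\<close>. This yields the Lipschitz constants of the next two lemmas.\<close>

lemma dist_stereo_sq:
  "(dist (stereo u) (stereo v))\<^sup>2 = 4 * (u - v)\<^sup>2 / ((1 + u\<^sup>2) * (1 + v\<^sup>2))"
proof -
  define A B where "A = 1 + u\<^sup>2" and "B = 1 + v\<^sup>2"
  have nz: "A \<noteq> 0" "B \<noteq> 0" unfolding A_def B_def by (rule one_plus_square_neq_0)+
  have "((1 - u\<^sup>2) / A - (1 - v\<^sup>2) / B)\<^sup>2 + (2 * u / A - 2 * v / B)\<^sup>2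
      = (((1 - u\<^sup>2) * B - (1 - v\<^sup>2) * A)\<^sup>2 + (2 * u * B - 2 * v * A)\<^sup>2) / (A * B)\<^sup>2"
    using nz by (simp add: diff_frac_eq power_divide add_divide_distrib)
  also have "((1 - u\<^sup>2) * B - (1 - v\<^sup>2) * A)\<^sup>2 + (2 * u * B - 2 * v * A)\<^sup>2 = 4 * (u - v)\<^sup>2 * (A * B)"
    unfolding A_def B_def by algebra
  also have "\<dots> / (A * B)\<^sup>2 = 4 * (u - v)\<^sup>2 / (A * B)"
    using nz by (simp add: power2_eq_square)
  finally show ?thesis unfolding dist_vec2_sq by (simp add: A_def B_def)
qed

lemma dist_stereo_le: "dist (stereo u) (stereo v) \<le> 2 * \<bar>u - v\<bar>"
proof (rule power2_le_imp_le)
  have "1 * 1 \<le> (1 + u\<^sup>2) * (1 + v\<^sup>2)" by (intro mult_mono) auto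
  then have "4 * (u - v)\<^sup>2 / ((1 + u\<^sup>2) * (1 + v\<^sup>2)) \<le> 4 * (u - v)\<^sup>2 / 1"
    by (intro divide_left_mono) auto
  then show "(dist (stereo u) (stereo v))\<^sup>2 \<le> (2 * \<bar>u - v\<bar>)\<^sup>2"
    unfolding dist_stereo_sq by (simp add: power_mult_distrib)
qed simp

lemma dist_stereo_ge:
  assumes "\<bar>u\<bar> \<le> 1" "\<bar>v\<bar> \<le> 1"
  shows "\<bar>u - v\<bar> \<le> dist (stereo u) (stereo v)"
proof (rule power2_le_imp_le)
  have "u\<^sup>2 \<le> 1" "v\<^sup>2 \<le> 1" using assms by (auto simp: abs_square_le_1)
  then have "(1 + u\<^sup>2) * (1 + v\<^sup>2) \<le> 2 * 2" by (intro mult_mono) auto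
  moreover have "0 < (1 + u\<^sup>2) * (1 + v\<^sup>2)" by (simp add: add_pos_nonneg)
  ultimately have "4 * (u - v)\<^sup>2 / 4 \<le> 4 * (u - v)\<^sup>2 / ((1 + u\<^sup>2) * (1 + v\<^sup>2))"
    by (intro divide_left_mono) auto
  then show "\<bar>u - v\<bar>\<^sup>2 \<le> (dist (stereo u) (stereo v))\<^sup>2"
    unfolding dist_stereo_sq by simp
qed simp

lemma component_diff_le_dist:
  fixes x y :: "real ^ 'n"
  shows "\<bar>x $ i - y $ i\<bar> \<le> dist x y"
  using dist_vec_nth_le[of x i y] by (simp add: dist_real_def)

definition rat_circle :: "nat \<Rightarrow> (real ^ 2) set" where
  "rat_circle Q = {P \<in> unit_circle. \<exists>(p1::int) (p2::int) q::nat. 0 < q \<and> q \<le> Q \<and>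
     P $ 1 = of_int p1 / real q \<and> P $ 2 = of_int p2 / real q}"

text \<open>For unit vectors the squared distance is 2 minus twice the inner product. Here it equals
  twice a positive integer over \<open>q * q'\<close>, so distances are of order
  \<open>1 / Q\<close>, not \<open>1 / Q\<^sup>2\<close> as for general rational points.\<close>

lemma rat_circle_separated:
  assumes "P \<in> rat_circle Q" "P' \<in> rat_circle Q" "P \<noteq> P'"
  shows "2 / (real Q)\<^sup>2 \<le> (dist P P')\<^sup>2"
proof -
  obtain p1 p2 :: int and q :: nat where p: "0 < q" "q \<le> Q" "P $ 1 = of_int p1 / real q" "P $ 2 = of_int p2 / real q"
    and c: "P \<in> unit_circle" using assms(1) unfolding rat_circle_def by auto
  obtain p1' p2' :: int and q' :: nat where p': "0 < q'" "q' \<le> Q" "P' $ 1 = of_int p1' / real q'" "P' $ 2 = of_int p2' / real q'"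
    and c': "P' \<in> unit_circle" using assms(2) unfolding rat_circle_def by auto
  define d where "d = int q * int q' - p1 * p1' - p2 * p2'"
  have "(dist P P')\<^sup>2 = 2 - 2 * (P $ 1 * P' $ 1 + P $ 2 * P' $ 2)"
    using c c' unfolding dist_vec2_sq unit_circle_def by (simp add: power2_eq_square algebra_simps)
  also have "\<dots> = 2 * of_int d / (real q * real q')"
    unfolding p(3,4) p'(3,4) d_def using p(1) p'(1) by (simp add: field_simps)
  finally have D: "(dist P P')\<^sup>2 = 2 * of_int d / (real q * real q')" .
  have "0 < (dist P P')\<^sup>2" using assms(3) by simp
  then have "0 < d" unfolding D using p(1) p'(1) by (simp add: zero_less_divide_iff mult_less_0_iff)
  then have "1 \<le> real_of_int d" by linarith
  have "2 / (real Q)\<^sup>2 \<le> 2 / (real q * real q')"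
    unfolding power2_eq_square using p(1,2) p'(1,2) by (intro divide_left_mono mult_mono) auto
  also have "\<dots> \<le> 2 * of_int d / (real q * real q')"
    using \<open>1 \<le> real_of_int d\<close> by (intro divide_right_mono) auto
  finally show ?thesis unfolding D .
qed

text \<open>On this quarter arc the circle is a graph over coordinate \<open>i\<close> of slope at
  most 1, so projecting to that coordinate shrinks distances by at most the square root of
  2.\<close>

lemma unit_circle_chord_le:
  fixes x y :: "real ^ 2"
  assumes "x \<in> unit_circle" "y \<in> unit_circle" and "{i, j} = {1, 2}"
    and "\<bar>x $ i\<bar> \<le> x $ j" "\<bar>y $ i\<bar> \<le> y $ j"
  shows "(dist x y)\<^sup>2 \<le> 2 * (x $ i - y $ i)\<^sup>2"
proof -
  define a b c d where "a = x $ i" and "b = x $ j" and "c = y $ i" and "d = y $ j"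
  have "(i = 1 \<and> j = 2) \<or> (i = 2 \<and> j = 1)" using assms(3) by (auto simp: doubleton_eq_iff)
  then have c1: "a\<^sup>2 + b\<^sup>2 = 1" "c\<^sup>2 + d\<^sup>2 = 1" and D: "(dist x y)\<^sup>2 = (a - c)\<^sup>2 + (b - d)\<^sup>2"
    using assms(1,2) unfolding unit_circle_def dist_vec2_sq a_def b_def c_def d_def by (auto simp: add.commute)
  have ab: "\<bar>a\<bar> \<le> b" "\<bar>c\<bar> \<le> d" using assms unfolding a_def b_def c_def d_def by auto
  have "b > 0"
  proof (rule ccontr)
    assume "\<not> 0 < b"
    then have "b = 0" "a = 0" using ab by auto
    then show False using c1 by simp
  qed
  then have bd: "b + d > 0" using ab by linarith
  have "\<bar>b - d\<bar> * (b + d) = \<bar>(b - d) * (b + d)\<bar>" using bd by (simp add: abs_mult)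
  also have "(b - d) * (b + d) = (c - a) * (c + a)" using c1 by (simp add: power2_eq_square algebra_simps)
  also have "\<bar>\<dots>\<bar> = \<bar>a - c\<bar> * \<bar>a + c\<bar>" by (simp add: abs_mult add.commute abs_minus_commute)
  also have "\<dots> \<le> \<bar>a - c\<bar> * (b + d)" using ab by (intro mult_left_mono) auto
  finally have "\<bar>b - d\<bar> \<le> \<bar>a - c\<bar>" using bd by simp
  then have "(b - d)\<^sup>2 \<le> (a - c)\<^sup>2" by (rule abs_le_square_iff[THEN iffD1])
  then show ?thesis unfolding D a_def c_def by simp
qed

lemma uminus_rat_circle:
  assumes "P \<in> rat_circle Q"
  shows "- P \<in> rat_circle Q"
proof -
  obtain p1 p2 :: int and q :: nat where p: "0 < q" "q \<le> Q" "P $ 1 = of_int p1 / real q" "P $ 2 = of_int p2 / real q"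
    and c: "P \<in> unit_circle" using assms unfolding rat_circle_def by auto
  have "(- P) $ 1 = of_int (- p1) / real q" "(- P) $ 2 = of_int (- p2) / real q" using p by simp_all
  moreover have "- P \<in> unit_circle" using c unfolding unit_circle_def by simp
  ultimately show ?thesis unfolding rat_circle_def using p(1,2) by blast
qed

text \<open>Four quarter arcs, two of them obtained by negation, cover the circle. Projection makes
  the points of each a \<open>1 / Q\<close>-separated subset of \<open>{-1..1}\<close>, which has at
  most \<open>2 * Q + 1 \<le> 3 * Q\<close> elements.\<close>

lemma card_rat_circle_le:
  assumes "0 < Q"
  shows "finite (rat_circle Q)" "card (rat_circle Q) \<le> 12 * Q"
proof -
  define X where "X i j = {P \<in> rat_circle Q. \<bar>P $ i\<bar> \<le> P $ j}" for i j :: 2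
  have X: "finite (X i j) \<and> card (X i j) \<le> 3 * Q" if ij: "{i, j} = {1, 2}" for i j
  proof -
    have sep: "1 / real Q \<le> \<bar>P $ i - P' $ i\<bar>" if "P \<in> X i j" "P' \<in> X i j" "P \<noteq> P'" for P P'
    proof -
      have "2 / (real Q)\<^sup>2 \<le> 2 * (P $ i - P' $ i)\<^sup>2"
        using rat_circle_separated[of P Q P'] unit_circle_chord_le[of P P' i j] that ij
        unfolding X_def rat_circle_def by fastforce
      then have "(1 / real Q)\<^sup>2 \<le> \<bar>P $ i - P' $ i\<bar>\<^sup>2" by (simp add: power_divide)
      then show ?thesis by (rule power2_le_imp_le) simp
    qed
    have inj: "inj_on (\<lambda>P. P $ i) (X i j)"
      using sep assms by (fastforce intro!: inj_onI)
    have abs1: "\<bar>P $ k\<bar> \<le> 1" if "P \<in> unit_circle" for P k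
    proof -
      have "(P $ k)\<^sup>2 \<le> (P $ 1)\<^sup>2 + (P $ 2)\<^sup>2" using exhaust_2[of k] by auto
      also have "\<dots> = 1" using that unfolding unit_circle_def by simp
      finally have "(P $ k)\<^sup>2 \<le> 1" .
      then show ?thesis by (simp add: abs_square_le_1)
    qed
    have sub: "(\<lambda>P. P $ i) ` X i j \<subseteq> {-1..1}"
      using abs1 unfolding X_def rat_circle_def by (auto simp: abs_le_iff minus_le_iff)
    have sep': "1 / real Q \<le> \<bar>x - y\<bar>" if "x \<in> (\<lambda>P. P $ i) ` X i j" "y \<in> (\<lambda>P. P $ i) ` X i j" "x \<noteq> y" for x y
      using sep that by blast
    note * = card_separated_le[OF _ _ sub sep']
    have "finite ((\<lambda>P. P $ i) ` X i j)" using *(1) assms by simp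
    then have "finite (X i j)" using inj by (rule finite_imageD)
    moreover have "real (card (X i j)) \<le> 2 * real Q + 1"
      using *(2) assms card_image[OF inj] by simp
    ultimately show ?thesis using assms by simp
  qed
  define U where "U = (X 1 2 \<union> X 2 1) \<union> (uminus ` X 1 2 \<union> uminus ` X 2 1)"
  have sub: "rat_circle Q \<subseteq> U"
  proof
    fix P assume P: "P \<in> rat_circle Q"
    then have nP: "- P \<in> rat_circle Q" by (rule uminus_rat_circle)
    have neg: "P \<in> uminus ` X i j" if "- P \<in> X i j" for i j
      using imageI[OF that, of uminus] by simp
    consider "\<bar>P $ 1\<bar> \<le> P $ 2" | "\<bar>P $ 2\<bar> \<le> P $ 1" | "\<bar>P $ 1\<bar> \<le> - P $ 2" | "\<bar>P $ 2\<bar> \<le> - P $ 1"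
      by linarith
    then have "P \<in> X 1 2 \<or> P \<in> X 2 1 \<or> - P \<in> X 1 2 \<or> - P \<in> X 2 1"
      using P nP unfolding X_def by cases simp_all
    then show "P \<in> U" unfolding U_def using neg by blast
  qed
  have c: "{1::2, 2} = {1, 2}" "{2::2, 1} = {1, 2}" by auto
  note X1 = X[OF c(1)] and X2 = X[OF c(2)]
  have finU: "finite U" unfolding U_def using X1 X2 by simp
  show "finite (rat_circle Q)" by (rule finite_subset[OF sub finU])
  have "card (rat_circle Q) \<le> card U" by (rule card_mono[OF finU sub])
  also have "\<dots> \<le> card (X 1 2 \<union> X 2 1) + card (uminus ` X 1 2 \<union> uminus ` X 2 1)"
    unfolding U_def by (rule card_Un_le)
  also have "\<dots> \<le> (card (X 1 2) + card (X 2 1)) + (card (uminus ` X 1 2) + card (uminus ` X 2 1))"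
    by (intro add_mono card_Un_le)
  also have "\<dots> \<le> (3 * Q + 3 * Q) + (3 * Q + 3 * Q)"
    using X1 X2 by (intro add_mono order_trans[OF card_image_le]) auto
  finally show "card (rat_circle Q) \<le> 12 * Q" by simp
qed

section \<open>Hausdorff measure\<close>

text \<open>Reindexing by \<open>to_nat_on\<close> admits covers indexed by pairs of a level and a
  rational point.\<close>

lemma premeasure_le_countable_cover:
  fixes F :: "'a::metric_space set" and c :: "'i \<Rightarrow> 'a" and r :: "'i \<Rightarrow> real"
  assumes "countable T" "\<And>t. t \<in> T \<Longrightarrow> 0 < r t \<and> r t \<le> \<rho>" "F \<subseteq> (\<Union>t\<in>T. ball (c t) (r t))"
  shows "hausdorff_premeasure f \<rho> F \<le> (\<Sum>\<^sub>\<infinity>t\<in>T. ennreal (f (r t)))"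
proof -
  define e where "e = from_nat_into T"
  define I where "I = to_nat_on T ` T"
  have e: "e (to_nat_on T t) = t" if "t \<in> T" for t
    unfolding e_def using assms(1) that by simp
  have "(\<Sum>\<^sub>\<infinity>i\<in>I. ennreal (f (r (e i)))) = (\<Sum>\<^sub>\<infinity>t\<in>T. ennreal (f (r t)))"
    unfolding I_def by (subst infsum_reindex[OF inj_on_to_nat_on[OF assms(1)]]) (auto intro!: infsum_cong simp: e)
  moreover have "hausdorff_premeasure f \<rho> F \<le> (\<Sum>\<^sub>\<infinity>i\<in>I. ennreal (f (r (e i))))"
    unfolding hausdorff_premeasure_def
  proof (rule Inf_lower, intro CollectI exI conjI)
    show "\<forall>i\<in>I. 0 < r (e i) \<and> r (e i) \<le> \<rho>" using assms(2) unfolding I_def by (auto simp: e)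
    show "F \<subseteq> (\<Union>i\<in>I. ball (c (e i)) (r (e i)))" using assms(3) unfolding I_def by (auto simp: e)
  qed (rule refl)
  ultimately show ?thesis by simp
qed

lemma infsum_ennreal_leI:
  fixes g :: "'i \<Rightarrow> ennreal"
  assumes "\<And>A. finite A \<Longrightarrow> A \<subseteq> T \<Longrightarrow> sum g A \<le> B"
  shows "infsum g T \<le> B"
proof -
  have "infsum g T = (SUP A\<in>{A. finite A \<and> A \<subseteq> T}. sum g A)"
    by (rule nonneg_infsum_complete) simp
  also have "\<dots> \<le> B" using assms by (intro SUP_least) auto
  finally show ?thesis .
qed

lemma sum_le_infsum_ennreal:
  fixes g :: "'i \<Rightarrow> ennreal"
  assumes "finite A" "A \<subseteq> T"
  shows "sum g A \<le> infsum g T"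
proof -
  have "sum g A \<le> (SUP A\<in>{A. finite A \<and> A \<subseteq> T}. sum g A)"
    using assms by (intro SUP_upper) auto
  also have "\<dots> = infsum g T" by (rule nonneg_infsum_complete[symmetric]) simp
  finally show ?thesis .
qed

lemma dimension_functionD:
  assumes "dimension_function f"
  shows "r > 0 \<Longrightarrow> f r > 0" "0 < x \<Longrightarrow> x \<le> y \<Longrightarrow> f x \<le> f y" "(f \<longlongrightarrow> 0) (at_right 0)"
  using assms monotone_onD[of "{0<..}" "(\<le>)" "(\<le>)" f x y]
  unfolding dimension_function_def by auto

text \<open>Enlarging radii by a constant factor thus costs at most that factor.\<close>

lemma antimono_ratio_mult_le:
  fixes f :: "real \<Rightarrow> real"
  assumes "antimono_on {0<..} (\<lambda>r. f r / r)" "0 < x" "1 \<le> C"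
  shows "f (C * x) \<le> C * f x"
proof -
  have "x \<le> C * x" using assms by simp
  then have "f (C * x) / (C * x) \<le> f x / x" using assms by (intro antimono_ratioD) auto
  then show ?thesis using assms by (simp add: field_simps)
qed

text \<open>Each squared coordinate changes by at most \<open>3 * e\<close>, so the integer
  \<open>q\<^sup>2 - (p1\<^sup>2 + p2\<^sup>2)\<close> has absolute value at most
  \<open>6 * q\<^sup>2 * e < 1\<close> and vanishes.\<close>

lemma approximant_on_circle:
  fixes x :: "real ^ 2" and p1 p2 q :: int
  assumes x: "x \<in> unit_circle" and "q \<noteq> 0" and e: "(of_int \<bar>q\<bar>)\<^sup>2 * e < 1/8" "e \<le> 1/2"
    and p: "\<bar>x $ 1 - of_int p1 / of_int q\<bar> < e" "\<bar>x $ 2 - of_int p2 / of_int q\<bar> < e"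
  shows "p1\<^sup>2 + p2\<^sup>2 = q\<^sup>2"
proof -
  define a b where "a = x $ 1" and "b = x $ 2"
  define y z where "y = of_int p1 / real_of_int q" and "z = of_int p2 / real_of_int q"
  have ab: "a\<^sup>2 + b\<^sup>2 = 1" using x unfolding unit_circle_def a_def b_def by simp
  have "a\<^sup>2 \<le> 1" "b\<^sup>2 \<le> 1" using ab zero_le_power2[of a] zero_le_power2[of b] by linarith+
  then have ab1: "\<bar>a\<bar> \<le> 1" "\<bar>b\<bar> \<le> 1" by (simp_all add: abs_square_le_1)
  have sq: "\<bar>s\<^sup>2 - t\<^sup>2\<bar> \<le> 3 * e" if "\<bar>s\<bar> \<le> 1" "\<bar>s - t\<bar> < e" for s t :: real
  proof -
    have "\<bar>s\<^sup>2 - t\<^sup>2\<bar> = \<bar>s - t\<bar> * \<bar>s + t\<bar>" by (simp add: power2_eq_square algebra_simps flip: abs_mult)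
    also have "\<dots> \<le> e * 3" using that e(2) by (intro mult_mono) auto
    finally show ?thesis by simp
  qed
  have "\<bar>a\<^sup>2 - y\<^sup>2\<bar> \<le> 3 * e" "\<bar>b\<^sup>2 - z\<^sup>2\<bar> \<le> 3 * e"
    using sq[OF ab1(1), of y] sq[OF ab1(2), of z] p unfolding a_def b_def y_def z_def by auto
  then have "\<bar>1 - (y\<^sup>2 + z\<^sup>2)\<bar> \<le> 6 * e" using ab by linarith
  then have "(of_int q)\<^sup>2 * \<bar>1 - (y\<^sup>2 + z\<^sup>2)\<bar> \<le> (of_int q)\<^sup>2 * (6 * e)"
    by (intro mult_left_mono) auto
  also have "\<dots> < 1" using e(1) by simp
  also have "(of_int q)\<^sup>2 * \<bar>1 - (y\<^sup>2 + z\<^sup>2)\<bar> = \<bar>(of_int q)\<^sup>2 * (1 - (y\<^sup>2 + z\<^sup>2))\<bar>"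
    by (simp add: abs_mult)
  also have "(of_int q)\<^sup>2 * (1 - (y\<^sup>2 + z\<^sup>2)) = of_int (q\<^sup>2 - (p1\<^sup>2 + p2\<^sup>2))"
    using \<open>q \<noteq> 0\<close> unfolding y_def z_def by (simp add: field_simps)
  finally have "\<bar>q\<^sup>2 - (p1\<^sup>2 + p2\<^sup>2)\<bar> < 1" by linarith
  then show ?thesis by linarith
qed

text \<open>Bounded denominators force bounded numerators, as \<open>\<psi>\<close> is at most
  \<open>\<psi> 1\<close> there; infinitely many triples would then be impossible.\<close>

lemma circle_approximable_unbounded:
  assumes psi_decreasing: "antimono_on {0<..} \<psi>" and x: "x \<in> circle_approximable \<psi>"
  obtains p1 p2 q :: int where "N < \<bar>q\<bar>" "q \<noteq> 0"
    "\<bar>x $ 1 - of_int p1 / of_int q\<bar> < \<psi> (of_int \<bar>q\<bar>)" "\<bar>x $ 2 - of_int p2 / of_int q\<bar> < \<psi> (of_int \<bar>q\<bar>)"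
proof (rule ccontr)
  note found = that
  assume neg: "\<not> thesis"
  define X where "X = {(p1 :: int, p2 :: int, q :: int). q \<noteq> 0 \<and>
          \<bar>x $ 1 - of_int p1 / of_int q\<bar> < \<psi> (of_int \<bar>q\<bar>) \<and>
          \<bar>x $ 2 - of_int p2 / of_int q\<bar> < \<psi> (of_int \<bar>q\<bar>)}"
  define B where "B = \<lceil>of_int N * (\<bar>x $ 1\<bar> + \<bar>x $ 2\<bar> + \<psi> 1)\<rceil>"
  have "X \<subseteq> {-B..B} \<times> {-B..B} \<times> {-N..N}"
  proof
    fix t assume "t \<in> X"
    then obtain p1 p2 q where t: "t = (p1, p2, q)" "(p1, p2, q) \<in> X" by (cases t) auto
    from t(2) have q: "q \<noteq> 0" and p: "\<bar>x $ 1 - of_int p1 / of_int q\<bar> < \<psi> (of_int \<bar>q\<bar>)"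
      "\<bar>x $ 2 - of_int p2 / of_int q\<bar> < \<psi> (of_int \<bar>q\<bar>)" unfolding X_def by auto
    have qN: "\<bar>q\<bar> \<le> N" using neg found[OF _ q p] by (meson not_less)
    have "\<psi> (of_int \<bar>q\<bar>) \<le> \<psi> 1" using monotone_onD[OF psi_decreasing, of 1 "of_int \<bar>q\<bar>"] q by simp
    have bound: "\<bar>m\<bar> \<le> B" if "\<bar>t - of_int m / of_int q\<bar> < \<psi> (of_int \<bar>q\<bar>)" "\<bar>t\<bar> \<le> \<bar>x $ 1\<bar> + \<bar>x $ 2\<bar>" for m t
    proof -
      have "\<bar>real_of_int m\<bar> = \<bar>real_of_int q\<bar> * \<bar>of_int m / of_int q\<bar>" using q by (simp add: abs_divide)
      also have "\<dots> \<le> of_int N * (\<bar>x $ 1\<bar> + \<bar>x $ 2\<bar> + \<psi> 1)"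
      proof (rule mult_mono)
        show "\<bar>real_of_int q\<bar> \<le> of_int N" using qN by linarith
        show "\<bar>of_int m / of_int q\<bar> \<le> \<bar>x $ 1\<bar> + \<bar>x $ 2\<bar> + \<psi> 1"
          using that \<open>\<psi> (of_int \<bar>q\<bar>) \<le> \<psi> 1\<close> by linarith
        show "0 \<le> real_of_int N" using qN by linarith
      qed simp
      finally show ?thesis unfolding B_def by linarith
    qed
    have "\<bar>p1\<bar> \<le> B" "\<bar>p2\<bar> \<le> B" using bound[OF p(1)] bound[OF p(2)] by auto
    then show "t \<in> {-B..B} \<times> {-B..B} \<times> {-N..N}" using qN unfolding t by auto
  qed
  then have "finite X" by (rule finite_subset) simp
  then show False using x unfolding circle_approximable_def X_def by simp
qed

section \<open>The convergence case\<close>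

lemma hausdorff_measure_convergent:
  fixes \<psi> f :: "real \<Rightarrow> real"
  assumes psi_pos: "\<forall>r>0. \<psi> r > 0"
    and psi_decreasing: "antimono_on {0<..} \<psi>"
    and psi_limit: "((\<lambda>r. r\<^sup>2 * \<psi> r) \<longlongrightarrow> 0) at_top"
    and f_dim: "dimension_function f"
    and f_decreasing: "antimono_on {0<..} (\<lambda>r. f r / r)"
    and conv: "summable (\<lambda>k. 2 ^ k * f (\<psi> (2 ^ k)))"
  shows "hausdorff_measure f (circle_approximable \<psi>) = 0"
proof -
  note f = dimension_functionD[OF f_dim]
  obtain R0 where R0: "\<And>r. R0 \<le> r \<Longrightarrow> \<bar>r\<^sup>2 * \<psi> r\<bar> < 1/8"
    using tendstoD[OF psi_limit, of "1/8"] by (auto simp: eventually_at_top_linorder dist_real_def)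
  have "hausdorff_premeasure f \<rho> (circle_approximable \<psi>) \<le> ennreal e" if "\<rho> > 0" "e > 0" for \<rho> e
  proof -
    \<comment> \<open>The factor 48 is 24 * 2: there are at most \<open>24 * 2 ^ k\<close> points in
      block \<open>k\<close>, and doubling the radius at most doubles the cost.\<close>
    obtain K where K: "\<And>m n. K \<le> m \<Longrightarrow> norm (\<Sum>k\<in>{m..<n}. 2 ^ k * f (\<psi> (2 ^ k))) < e / 48"
      using conv[unfolded summable_Cauchy, rule_format, of "e / 48"] \<open>e > 0\<close> by auto
    obtain R1 where R1: "\<And>r. R1 \<le> r \<Longrightarrow> \<bar>r\<^sup>2 * \<psi> r\<bar> < \<rho> / 2"
      using tendstoD[OF psi_limit, of "\<rho> / 2"] \<open>\<rho> > 0\<close> by (auto simp: eventually_at_top_linorder dist_real_def)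
    obtain K' :: nat where K': "max R0 (max R1 1) \<le> 2 ^ K'"
    proof -
      obtain n :: nat where "max R0 (max R1 1) < 2 ^ n" using real_arch_pow[of 2 "max R0 (max R1 1)"] by auto
      then show ?thesis using that[of n] by simp
    qed
    define M where "M = max K K'"
    have M: "R0 \<le> r" "R1 \<le> r" "1 \<le> r" if "2 ^ M \<le> r" for r :: real
    proof -
      have "(2::real) ^ K' \<le> 2 ^ M" unfolding M_def by (intro power_increasing) auto
      with K' that have "max R0 (max R1 1) \<le> r" by linarith
      then show "R0 \<le> r" "R1 \<le> r" "1 \<le> r" by auto
    qed
    \<comment> \<open>Taking all rational points of height at most \<open>2 ^ Suc k\<close>, not only the new ones, also covers the
      rational points of the circle, which are approximated by their own non-primitive triples.\<close>
    define T where "T = Sigma {M..} (\<lambda>k. rat_circle (2 ^ Suc k))"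
    define r where "r t = 2 * \<psi> (2 ^ fst t)" for t :: "nat \<times> (real ^ 2)"
    have fin: "finite (rat_circle (2 ^ Suc k))" for k by (rule card_rat_circle_le) simp
    have "hausdorff_premeasure f \<rho> (circle_approximable \<psi>) \<le> (\<Sum>\<^sub>\<infinity>t\<in>T. ennreal (f (r t)))"
    proof (rule premeasure_le_countable_cover[where c = snd])
      show "countable T" unfolding T_def by (intro countable_SIGMA countable_finite[OF fin]) simp
      show "0 < r t \<and> r t \<le> \<rho>" if "t \<in> T" for t
      proof -
        define a :: real where "a = 2 ^ fst t"
        have "2 ^ M \<le> a" using that unfolding T_def a_def by (auto intro!: power_increasing)
        note a = M[OF this]
        have "\<psi> a > 0" using psi_pos a by simp
        moreover have "\<psi> a \<le> a\<^sup>2 * \<psi> a" using a(3) \<open>\<psi> a > 0\<close> by (simp add: one_le_power)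
        ultimately show ?thesis using R1[OF a(2)] unfolding r_def a_def[symmetric] by linarith
      qed
      show "circle_approximable \<psi> \<subseteq> (\<Union>t\<in>T. ball (snd t) (r t))"
      proof
        fix x assume x: "x \<in> circle_approximable \<psi>"
        obtain p1 p2 q :: int where q: "2 ^ M < \<bar>q\<bar>" "q \<noteq> 0"
          and p: "\<bar>x $ 1 - of_int p1 / of_int q\<bar> < \<psi> (of_int \<bar>q\<bar>)" "\<bar>x $ 2 - of_int p2 / of_int q\<bar> < \<psi> (of_int \<bar>q\<bar>)"
          using circle_approximable_unbounded[OF psi_decreasing x] .
        define Q where "Q = nat \<bar>q\<bar>"
        have Qr: "real_of_int \<bar>q\<bar> = real Q" unfolding Q_def by simp
        have "2 ^ M < Q" using q(1) unfolding Q_def by (simp add: zless_nat_eq_int_zless)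
        obtain k where k: "2 ^ k < Q" "Q \<le> 2 ^ Suc k" "M \<le> k"
        proof -
          \<comment> \<open>The dyadic block with \<open>2 ^ k < Q \<le> 2 ^ Suc k\<close>. The
            lower bound gives \<open>\<psi> Q \<le> \<psi> (2 ^ k)\<close>, the upper one places the
            approximant in \<open>rat_circle (2 ^ Suc k)\<close>.\<close>
          define k where "k = (LEAST j. Q \<le> 2 ^ Suc j)"
          have ex: "Q \<le> 2 ^ Suc Q" using less_exp[of "Suc Q"] by simp
          have k1: "Q \<le> 2 ^ Suc k" unfolding k_def by (rule LeastI[where P = "\<lambda>j. Q \<le> 2 ^ Suc j", OF ex])
          have "(2::nat) ^ M < 2 ^ Suc k" using \<open>2 ^ M < Q\<close> k1 by linarith
          then have "M \<le> k" by (simp add: power_strict_increasing_iff del: power_Suc)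
          moreover have "2 ^ k < Q"
          proof (cases k)
            case 0
            have "(1::nat) \<le> 2 ^ M" by simp
            then have "1 < Q" using \<open>2 ^ M < Q\<close> by linarith
            then show ?thesis using 0 by simp
          next
            case (Suc j)
            then have "\<not> Q \<le> 2 ^ Suc j" using not_less_Least[of j "\<lambda>j. Q \<le> 2 ^ Suc j"] unfolding k_def by simp
            then show ?thesis using Suc by simp
          qed
          ultimately show ?thesis using that k1 by blast
        qed
        have kQ: "(2::real) ^ k \<le> real Q" using k(1) by (metis less_imp_le of_nat_le_iff of_nat_numeral of_nat_power)
        have "2 ^ M \<le> (2::real) ^ k" using k(3) by (intro power_increasing) auto
        then have MQ: "2 ^ M \<le> real Q" using kQ by linarith
        have psiQ: "\<psi> (real Q) > 0" using psi_pos M(3)[OF MQ] by simp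
        have small: "(real Q)\<^sup>2 * \<psi> (real Q) < 1/8" using R0[OF M(1)[OF MQ]] by linarith
        have "\<psi> (real Q) \<le> (real Q)\<^sup>2 * \<psi> (real Q)"
          using M(3)[OF MQ] psiQ by (simp add: one_le_power)
        then have "\<psi> (real Q) \<le> 1/2" using small by linarith
        have xc: "x \<in> unit_circle" using x unfolding circle_approximable_def by simp
        have on: "p1\<^sup>2 + p2\<^sup>2 = q\<^sup>2"
          using approximant_on_circle[OF xc q(2), of "\<psi> (real Q)" p1 p2] p small \<open>\<psi> (real Q) \<le> 1/2\<close> unfolding Qr by simp
        define P :: "real ^ 2" where "P = vector [of_int p1 / of_int q, of_int p2 / of_int q]"
        have P: "P $ 1 = of_int p1 / of_int q" "P $ 2 = of_int p2 / of_int q"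
          unfolding P_def by (simp_all add: vector_2)
        have "P \<in> unit_circle"
        proof -
          have "(real_of_int p1)\<^sup>2 + (real_of_int p2)\<^sup>2 = (real_of_int q)\<^sup>2"
            using on by (metis of_int_add of_int_power)
          then show ?thesis using q(2) unfolding unit_circle_def P
            by (simp add: P power_divide add_divide_distrib[symmetric])
        qed
        moreover have "0 < Q" using q(2) unfolding Q_def by simp
        moreover have "P $ 1 = of_int (sgn q * p1) / real Q \<and> P $ 2 = of_int (sgn q * p2) / real Q"
          using q(2) unfolding P Qr[symmetric] by (cases "q > 0") auto
        ultimately have "P \<in> rat_circle (2 ^ Suc k)" unfolding rat_circle_def using k(2) by blast
        then have "(k, P) \<in> T" unfolding T_def using k(3) by simp
        moreover have "x \<in> ball (snd (k, P)) (r (k, P))"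
        proof -
          \<comment> \<open>The two coordinate errors add up, which is why the radii are
            \<open>2 * \<psi> (2 ^ k)\<close>.\<close>
          have "dist P x \<le> \<bar>P $ 1 - x $ 1\<bar> + \<bar>P $ 2 - x $ 2\<bar>"
            unfolding dist_vec_def using L2_set_le_sum_abs[of "\<lambda>i. dist (P $ i) (x $ i)" UNIV]
            by (simp add: sum_2 dist_real_def)
          also have "\<dots> < 2 * \<psi> (real Q)" using p unfolding P Qr by linarith
          also have "\<dots> \<le> 2 * \<psi> (2 ^ k)"
            using monotone_onD[OF psi_decreasing, of "2 ^ k" "real Q"] kQ \<open>0 < Q\<close> by simp
          finally show ?thesis by (simp add: r_def)
        qed
        ultimately show "x \<in> (\<Union>t\<in>T. ball (snd t) (r t))" by blast
      qed
    qed
    also have "\<dots> \<le> ennreal e"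
    proof (rule infsum_ennreal_leI)
      fix A assume A: "finite A" "A \<subseteq> T"
      have fr: "0 \<le> f (r t)" for t
      proof -
        have "\<psi> (2 ^ fst t) > 0" using psi_pos by simp
        then show ?thesis using f(1)[of "r t"] unfolding r_def by simp
      qed
      define n where "n = Suc (Max (insert 0 (fst ` A)))"
      have "fst t < n" if "t \<in> A" for t
      proof -
        have "fst t \<le> Max (insert 0 (fst ` A))" using that A by (intro Max_ge) auto
        then show ?thesis unfolding n_def by simp
      qed
      then have sub: "A \<subseteq> Sigma {M..<n} (\<lambda>k. rat_circle (2 ^ Suc k))" using A unfolding T_def by auto
      have "(\<Sum>t\<in>A. f (r t)) \<le> (\<Sum>t\<in>Sigma {M..<n} (\<lambda>k. rat_circle (2 ^ Suc k)). f (r t))"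
        using sub fin fr by (intro sum_mono2) auto
      also have "\<dots> = (\<Sum>k\<in>{M..<n}. \<Sum>P\<in>rat_circle (2 ^ Suc k). f (2 * \<psi> (2 ^ k)))"
        using fin by (subst sum.Sigma) (auto simp: r_def intro!: sum.cong)
      also have "\<dots> = (\<Sum>k\<in>{M..<n}. real (card (rat_circle (2 ^ Suc k))) * f (2 * \<psi> (2 ^ k)))" by simp
      also have "\<dots> \<le> (\<Sum>k\<in>{M..<n}. (24 * 2 ^ k) * (2 * f (\<psi> (2 ^ k))))"
      proof (intro sum_mono mult_mono)
        fix k
        have "card (rat_circle (2 ^ Suc k)) \<le> 12 * 2 ^ Suc k" by (rule card_rat_circle_le) simp
        then have "real (card (rat_circle (2 ^ Suc k))) \<le> real (12 * 2 ^ Suc k)" by (simp only: of_nat_le_iff)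
        then show "real (card (rat_circle (2 ^ Suc k))) \<le> 24 * 2 ^ k" by simp
        have "\<psi> (2 ^ k) > 0" using psi_pos by simp
        then show "f (2 * \<psi> (2 ^ k)) \<le> 2 * f (\<psi> (2 ^ k))" "0 \<le> f (2 * \<psi> (2 ^ k))"
          using antimono_ratio_mult_le[OF f_decreasing, of "\<psi> (2 ^ k)" 2] f(1)[of "2 * \<psi> (2 ^ k)"] by auto
      qed simp
      also have "\<dots> = 48 * (\<Sum>k\<in>{M..<n}. 2 ^ k * f (\<psi> (2 ^ k)))" by (simp add: sum_distrib_left mult_ac)
      also have "\<dots> \<le> e"
      proof -
        have "norm (\<Sum>k\<in>{M..<n}. 2 ^ k * f (\<psi> (2 ^ k))) < e / 48" by (rule K) (simp add: M_def)
        then show ?thesis unfolding real_norm_def by linarith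
      qed
      finally show "(\<Sum>t\<in>A. ennreal (f (r t))) \<le> ennreal e"
        using fr by (simp add: sum_ennreal ennreal_leI)
    qed
    finally show ?thesis .
  qed
  note small = this
  have "hausdorff_premeasure f \<rho> (circle_approximable \<psi>) \<le> 0" if "\<rho> > 0" for \<rho>
  proof (rule ennreal_le_epsilon)
    fix e :: real assume "0 < e"
    then show "hausdorff_premeasure f \<rho> (circle_approximable \<psi>) \<le> 0 + ennreal e"
      using small[OF \<open>\<rho> > 0\<close>] by simp
  qed
  then have "(SUP \<rho>\<in>{0<..}. hausdorff_premeasure f \<rho> (circle_approximable \<psi>)) \<le> 0"
    by (intro SUP_least) simp
  then show ?thesis unfolding hausdorff_measure_eq_SUP by simp
qed

section \<open>The divergence case\<close>

lemma summable_div_nat: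
  fixes b :: "nat \<Rightarrow> real"
  assumes "summable b" "\<And>k. 0 \<le> b k" "0 < d"
  shows "summable (\<lambda>j. b (j div d))"
proof (rule summableI_nonneg_bounded)
  show "(\<Sum>j<n. b (j div d)) \<le> real d * suminf b" for n
  proof -
    have "n * 1 \<le> n * d" using \<open>0 < d\<close> by (intro mult_left_mono) auto
    then have "(\<Sum>j<n. b (j div d)) \<le> (\<Sum>j<n * d. b (j div d))"
      using assms(2) by (intro sum_mono2) auto
    also have "\<dots> = (\<Sum>m<n. \<Sum>j\<in>{m * d..<m * d + d}. b (j div d))"
      by (rule sum.nat_group[symmetric])
    also have "\<dots> = (\<Sum>m<n. \<Sum>j\<in>{m * d..<m * d + d}. b m)"
    proof (intro sum.cong refl)
      fix m j assume "j \<in> {m * d..<m * d + d}"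
      then have "j div d = m" by (intro div_nat_eqI) (auto simp: mult.commute)
      then show "b (j div d) = b m" by simp
    qed
    also have "\<dots> = real d * (\<Sum>m<n. b m)" by (simp add: sum_distrib_left)
    also have "\<dots> \<le> real d * suminf b"
      using assms by (intro mult_left_mono sum_le_suminf) auto
    finally show ?thesis .
  qed
qed (rule assms(2))

text \<open>A level-\<open>k\<close> fraction \<open>m / n\<close> maps to a rational point of
  denominator at most \<open>2 * 16 ^ k\<close>, and the factor 4 outweighs the Lipschitz constant 2
  strictly. Different levels give different triples, since the levels are disjoint and the triple
  determines \<open>m / n\<close>.\<close>

lemma stereo_approximable:
  fixes \<psi> :: "real \<Rightarrow> real"
  assumes psi_pos: "\<forall>r>0. \<psi> r > 0" and psi_decreasing: "antimono_on {0<..} \<psi>"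
    and v: "infinite {k. \<exists>y\<in>farey_new k. \<bar>v - y\<bar> \<le> \<psi> (2 * 16 ^ k) / 4}"
  shows "stereo v \<in> circle_approximable \<psi>"
proof -
  define X where "X = {(p1 :: int, p2 :: int, q :: int). q \<noteq> 0 \<and>
          \<bar>stereo v $ 1 - of_int p1 / of_int q\<bar> < \<psi> (of_int \<bar>q\<bar>) \<and>
          \<bar>stereo v $ 2 - of_int p2 / of_int q\<bar> < \<psi> (of_int \<bar>q\<bar>)}"
  define L where "L = {k. \<exists>y\<in>farey_new k. \<bar>v - y\<bar> \<le> \<psi> (2 * 16 ^ k) / 4}"
  \<comment> \<open>\<open>h\<close> recovers the parameter \<open>m / n\<close> from the triple \<open>(n\<^sup>2 - m\<^sup>2, 2 m n, n\<^sup>2 + m\<^sup>2)\<close>.\<close>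
  define h where "h t = (case t of (p1, p2, q) \<Rightarrow> of_int p2 / real_of_int (q + p1))" for t :: "int \<times> int \<times> int"
  have "\<exists>t\<in>X. h t \<in> farey_new k" if "k \<in> L" for k
  proof -
    obtain y where y: "y \<in> farey_new k" "\<bar>v - y\<bar> \<le> \<psi> (2 * 16 ^ k) / 4" using \<open>k \<in> L\<close> unfolding L_def by auto
    then obtain m n where mn: "y = real m / real n" "0 < n" "n \<le> 4 ^ k" "m \<le> n"
      unfolding farey_new_def farey_def by auto
    define p1 p2 q where "p1 = (int n)\<^sup>2 - (int m)\<^sup>2" and "p2 = 2 * int m * int n" and "q = (int n)\<^sup>2 + (int m)\<^sup>2"
    have "0 < q" unfolding q_def using mn(2) by (simp add: add_pos_nonneg)
    have q_real: "real_of_int q = (real n)\<^sup>2 + (real m)\<^sup>2" unfolding q_def by simp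
    have "(real n)\<^sup>2 \<le> (real (4 ^ k))\<^sup>2" "(real m)\<^sup>2 \<le> (real (4 ^ k))\<^sup>2"
      using mn by (intro power_mono, simp_all only: of_nat_le_iff of_nat_0_le_iff)+
    moreover have "(real (4 ^ k))\<^sup>2 = 16 ^ k" by (simp add: power2_eq_square flip: power_mult_distrib)
    ultimately have q_le: "real_of_int q \<le> 2 * 16 ^ k" unfolding q_real by linarith
    have psi_le: "\<psi> (2 * 16 ^ k) \<le> \<psi> (of_int q)"
      using monotone_onD[OF psi_decreasing, of "of_int q" "2 * 16 ^ k"] q_le \<open>0 < q\<close> by simp
    have st: "stereo y $ 1 = of_int p1 / of_int q" "stereo y $ 2 = of_int p2 / of_int q"
    proof -
      have nn: "real n * real n \<noteq> 0" using mn(2) by simp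
      have e: "1 + y\<^sup>2 = of_int q / (real n * real n)" "1 - y\<^sup>2 = of_int p1 / (real n * real n)"
        "2 * y = of_int p2 / (real n * real n)"
        unfolding mn(1) p1_def p2_def q_def using mn(2) by (simp_all add: field_simps power2_eq_square)
      show "stereo y $ 1 = of_int p1 / of_int q" "stereo y $ 2 = of_int p2 / of_int q"
        unfolding stereo_nth e using nn by simp_all
    qed
    have "dist (stereo v) (stereo y) < \<psi> (of_int q)"
    proof -
      have "dist (stereo v) (stereo y) \<le> 2 * \<bar>v - y\<bar>" by (rule dist_stereo_le)
      also have "\<dots> \<le> \<psi> (2 * 16 ^ k) / 2" using y(2) by simp
      also have "\<dots> < \<psi> (2 * 16 ^ k)" using psi_pos by simp
      finally show ?thesis using psi_le by linarith
    qed
    then have "\<bar>stereo v $ i - stereo y $ i\<bar> < \<psi> (of_int q)" for i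
      using component_diff_le_dist[of "stereo v" i "stereo y"] by linarith
    then have "(p1, p2, q) \<in> X"
      using \<open>0 < q\<close> unfolding X_def using st[symmetric] by (simp del: stereo_nth)
    moreover have "h (p1, p2, q) = y"
    proof -
      have "q + p1 = 2 * int n * int n" unfolding q_def p1_def by (simp add: power2_eq_square)
      moreover have "h (p1, p2, q) = of_int p2 / of_int (q + p1)" unfolding h_def by simp
      ultimately show ?thesis using mn(2) by (simp add: mn(1) p2_def)
    qed
    ultimately show ?thesis using y(1) by blast
  qed
  then obtain t where t: "\<And>k. k \<in> L \<Longrightarrow> t k \<in> X" "\<And>k. k \<in> L \<Longrightarrow> h (t k) \<in> farey_new k" by metis
  have "inj_on t L"
  proof (rule inj_onI, rule ccontr)
    fix j k assume jk: "j \<in> L" "k \<in> L" "t j = t k" "j \<noteq> k"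
    then have "h (t j) \<in> farey_new j \<inter> farey_new k" using t(2)[of j] t(2)[of k] by simp
    then show False using farey_new_disjoint[of j k] farey_new_disjoint[of k j] jk(4) by (auto simp: neq_iff)
  qed
  then have "infinite (t ` L)" using v unfolding L_def[symmetric] by (simp add: finite_image_iff)
  then have "infinite X" using t(1) by (meson image_subsetI infinite_super)
  then show ?thesis unfolding circle_approximable_def X_def using stereo_in_circle by simp
qed

lemma hausdorff_measure_divergent:
  fixes \<psi> f :: "real \<Rightarrow> real"
  assumes psi_pos: "\<forall>r>0. \<psi> r > 0"
    and psi_decreasing: "antimono_on {0<..} \<psi>"
    and psi_limit: "((\<lambda>r. r\<^sup>2 * \<psi> r) \<longlongrightarrow> 0) at_top"
    and f_dim: "dimension_function f"
    and f_limit: "filterlim (\<lambda>r. f r / r) at_top (at_right 0)"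
    and f_decreasing: "antimono_on {0<..} (\<lambda>r. f r / r)"
    and div: "\<not> summable (\<lambda>k. 2 ^ k * f (\<psi> (2 ^ k)))"
  shows "hausdorff_measure f (circle_approximable \<psi>) = \<infinity>"
proof (rule ccontr)
  note f = dimension_functionD[OF f_dim]
  define W where "W = circle_approximable \<psi>"
  assume "hausdorff_measure f (circle_approximable \<psi>) \<noteq> \<infinity>"
  then obtain B where B: "0 \<le> B" "hausdorff_measure f W = ennreal B"
    unfolding W_def by (cases "hausdorff_measure f (circle_approximable \<psi>)") auto
  define \<phi> where "\<phi> k = \<psi> (2 * 16 ^ k) / 4" for k :: nat
  have phi_pos: "\<phi> k > 0" for k unfolding \<phi>_def using psi_pos by simp
  \<comment> \<open>Eventually \<open>\<psi> r < 1 / r\<^sup>2\<close>, so the terms are dominated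
    by a geometric series.\<close>
  have phi_sum: "summable (\<lambda>k. 16 ^ k * \<phi> k)"
  proof (rule summable_comparison_test_ev)
    have "\<forall>\<^sub>F r in at_top. \<bar>r\<^sup>2 * \<psi> r\<bar> < 1"
      using tendstoD[OF psi_limit, of 1] by (simp add: dist_real_def)
    moreover have "filterlim (\<lambda>k. 2 * 16 ^ k :: real) at_top sequentially" by real_asymp
    ultimately have "\<forall>\<^sub>F k in sequentially. \<bar>(2 * 16 ^ k)\<^sup>2 * \<psi> (2 * 16 ^ k)\<bar> < 1"
      by (rule eventually_compose_filterlim)
    then show "\<forall>\<^sub>F k in sequentially. norm (16 ^ k * \<phi> k) \<le> (1 / 16) ^ k"
    proof eventually_elim
      case (elim k)
      have "(2 * 16 ^ k)\<^sup>2 * \<psi> (2 * 16 ^ k) = 16 * (16 ^ k * (16 ^ k * \<phi> k))"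
        unfolding \<phi>_def by (simp add: power2_eq_square)
      with elim have "\<bar>16 * (16 ^ k * (16 ^ k * \<phi> k))\<bar> < 1" by (simp only:)
      then have "16 ^ k * (16 ^ k * \<phi> k) \<le> 1" by linarith
      then have "16 ^ k * \<phi> k \<le> 1 / 16 ^ k" by (simp add: field_simps)
      then show ?case using phi_pos[of k] by (simp add: power_one_over)
    qed
  qed (simp add: summable_geometric)
  have div': "\<not> summable (\<lambda>k. 16 ^ k * f (\<phi> k))"
  proof
    assume "summable (\<lambda>k. 16 ^ k * f (\<phi> k))"
    \<comment> \<open>Repeating each term four times passes from base 16 to base 2: with
      \<open>k = j div 4\<close>, \<open>2 ^ Suc j\<close> lies between \<open>2 * 16 ^ k\<close>
      and \<open>16 * 16 ^ k\<close>.\<close>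
    then have "summable (\<lambda>j. 16 ^ (j div 4) * f (\<phi> (j div 4)))"
      using f(1)[OF phi_pos] by (intro summable_div_nat) (auto intro: less_imp_le)
    then have s: "summable (\<lambda>j. 64 * (16 ^ (j div 4) * f (\<phi> (j div 4))))" by (rule summable_mult)
    have "summable (\<lambda>j. 2 ^ Suc j * f (\<psi> (2 ^ Suc j)))"
    proof (rule summable_comparison_test'[OF s])
      fix j :: nat
      define k where "k = j div 4"
      have j: "4 * k \<le> j" "j \<le> 4 * k + 3" unfolding k_def by linarith+
      have p16: "(2::real) ^ (4 * k) = 16 ^ k" by (simp add: power_mult)
      have "(2::real) ^ Suc (4 * k) \<le> 2 ^ Suc j" using j by (intro power_increasing) auto
      then have lo: "2 * 16 ^ k \<le> (2::real) ^ Suc j" by (simp add: p16)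
      have "(2::real) ^ Suc j \<le> 2 ^ (4 * k + 4)" using j by (intro power_increasing) auto
      then have up: "(2::real) ^ Suc j \<le> 16 * 16 ^ k" by (simp add: power_add p16)
      have pp: "\<psi> (2 ^ Suc j) > 0" using psi_pos by simp
      have "\<psi> (2 ^ Suc j) \<le> 4 * \<phi> k"
        using monotone_onD[OF psi_decreasing, of "2 * 16 ^ k" "2 ^ Suc j"] lo by (simp add: \<phi>_def)
      then have "f (\<psi> (2 ^ Suc j)) \<le> f (4 * \<phi> k)" by (intro f(2) pp)
      also have "\<dots> \<le> 4 * f (\<phi> k)" by (rule antimono_ratio_mult_le[OF f_decreasing phi_pos]) simp
      finally have "2 ^ Suc j * f (\<psi> (2 ^ Suc j)) \<le> (16 * 16 ^ k) * (4 * f (\<phi> k))"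
        using up f(1)[OF pp] by (intro mult_mono) auto
      then show "norm (2 ^ Suc j * f (\<psi> (2 ^ Suc j))) \<le> 64 * (16 ^ (j div 4) * f (\<phi> (j div 4)))"
        using f(1)[OF pp] unfolding k_def[symmetric] by (simp del: power_Suc)
    qed
    then have "summable (\<lambda>k. 2 ^ k * f (\<psi> (2 ^ k)))"
      by (subst (asm) summable_Suc_iff[of "\<lambda>k. 2 ^ k * f (\<psi> (2 ^ k))"])
    with div show False by simp
  qed
  \<comment> \<open>Chosen so that \<open>2 * (B + 1) / E\<close> is 1/2048. Radii up to
    \<open>d / 4\<close> stay below \<open>d\<close> when doubled, so \<open>E\<close> bounds
    \<open>f r / r\<close> from below at the doubled radii.\<close>
  define E where "E = 4096 * (B + 1)"
  have "E > 0" unfolding E_def using B by simp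
  obtain d where d: "d > 0" "\<And>r. 0 < r \<Longrightarrow> r < d \<Longrightarrow> E \<le> f r / r"
    using f_limit unfolding filterlim_at_top eventually_at_right_field by metis
  have "hausdorff_premeasure f (d / 4) W \<le> hausdorff_measure f W"
    unfolding hausdorff_measure_eq_SUP using d(1) by (intro SUP_upper) simp
  also have "\<dots> < ennreal (B + 1)" unfolding B(2) using B(1) by (simp add: ennreal_less_iff)
  finally obtain I :: "nat set" and c :: "nat \<Rightarrow> real ^ 2" and r :: "nat \<Rightarrow> real"
    where r: "\<And>i. i \<in> I \<Longrightarrow> 0 < r i" "\<And>i. i \<in> I \<Longrightarrow> r i \<le> d / 4"
      and cover: "W \<subseteq> (\<Union>i\<in>I. ball (c i) (r i))"
      and sum_lt: "(\<Sum>\<^sub>\<infinity>i\<in>I. ennreal (f (r i))) < ennreal (B + 1)"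
    unfolding hausdorff_premeasure_def Inf_less_iff by auto
  \<comment> \<open>Only balls meeting the arc over the unit interval matter. In the parameter, such
    a ball lies within \<open>2 * r i\<close> of any of its points \<open>u i\<close>, because
    \<open>stereo\<close> does not shrink distances there; hence the doubled radii below.\<close>
  define I' where "I' = {i \<in> I. \<exists>v. 0 \<le> v \<and> v \<le> 1 \<and> stereo v \<in> ball (c i) (r i)}"
  have "\<forall>i\<in>I'. \<exists>v. 0 \<le> v \<and> v \<le> 1 \<and> stereo v \<in> ball (c i) (r i)" unfolding I'_def by simp
  then obtain u where u: "\<And>i. i \<in> I' \<Longrightarrow> 0 \<le> u i \<and> u i \<le> 1 \<and> stereo (u i) \<in> ball (c i) (r i)"
    by metis
  have f_sum: "(\<Sum>i\<in>A. f (2 * r i)) \<le> 2 * (B + 1)" if A: "finite A" "A \<subseteq> I'" for A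
  proof -
    have AI: "A \<subseteq> I" using A unfolding I'_def by auto
    have pos: "0 < f (r i)" if "i \<in> A" for i using f(1)[OF r(1)] AI that by auto
    have "ennreal (\<Sum>i\<in>A. f (r i)) = (\<Sum>i\<in>A. ennreal (f (r i)))"
      using pos by (subst sum_ennreal) (auto intro: less_imp_le)
    also have "\<dots> \<le> (\<Sum>\<^sub>\<infinity>i\<in>I. ennreal (f (r i)))" by (rule sum_le_infsum_ennreal[OF A(1) AI])
    also have "\<dots> \<le> ennreal (B + 1)" using sum_lt by simp
    finally have s: "(\<Sum>i\<in>A. f (r i)) \<le> B + 1" using B(1) by (subst (asm) ennreal_le_iff) auto
    have "(\<Sum>i\<in>A. f (2 * r i)) \<le> (\<Sum>i\<in>A. 2 * f (r i))"
      using antimono_ratio_mult_le[OF f_decreasing, of _ 2] r(1) AI by (intro sum_mono) auto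
    also have "\<dots> = 2 * (\<Sum>i\<in>A. f (r i))" by (simp add: sum_distrib_left)
    also have "\<dots> \<le> 2 * (B + 1)" by (rule mult_left_mono[OF s]) simp
    finally show ?thesis .
  qed
  have s_sum: "(\<Sum>i\<in>A. 2 * r i) \<le> 1 / 2048" if A: "finite A" "A \<subseteq> I'" for A
  proof -
    have "(\<Sum>i\<in>A. 2 * r i) \<le> (\<Sum>i\<in>A. f (2 * r i) / E)"
    proof (rule sum_mono)
      fix i assume "i \<in> A"
      then have i: "0 < r i" "r i \<le> d / 4" using r A unfolding I'_def by auto
      then have "E \<le> f (2 * r i) / (2 * r i)" using d(1) by (intro d(2)) auto
      then show "2 * r i \<le> f (2 * r i) / E" using i \<open>E > 0\<close> by (simp add: field_simps)
    qed
    also have "\<dots> = (\<Sum>i\<in>A. f (2 * r i)) / E" by (simp add: sum_divide_distrib)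
    also have "\<dots> \<le> 2 * (B + 1) / E" using f_sum[OF A] \<open>E > 0\<close> by (intro divide_right_mono) auto
    also have "\<dots> = 1 / 2048" unfolding E_def using B(1) by (simp add: field_simps)
    finally show ?thesis .
  qed
  have f_mono: "mono_on {0<..} f" using f_dim unfolding dimension_function_def by simp
  have s_pos: "0 < 2 * r i" if "i \<in> I'" for i using r(1) that unfolding I'_def by simp
  obtain v where v: "0 \<le> v" "v \<le> 1" "\<And>i. i \<in> I' \<Longrightarrow> 2 * r i \<le> \<bar>v - u i\<bar>"
    "infinite {k. \<exists>y\<in>farey_new k. \<bar>v - y\<bar> \<le> \<phi> k}"
    using exists_uncovered_point[OF f(1) f_mono f_decreasing phi_pos phi_sum div' s_pos f_sum s_sum, of I' u]
    by blast
  have "stereo v \<in> W"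
    unfolding W_def by (rule stereo_approximable[OF psi_pos psi_decreasing v(4)[unfolded \<phi>_def]])
  then obtain i where i: "i \<in> I" "stereo v \<in> ball (c i) (r i)" using cover by auto
  then have iI: "i \<in> I'" unfolding I'_def using v by auto
  have "\<bar>v - u i\<bar> \<le> dist (stereo v) (stereo (u i))"
    using u[OF iI] v(1,2) by (intro dist_stereo_ge) auto
  also have "\<dots> \<le> dist (c i) (stereo v) + dist (c i) (stereo (u i))" by (rule dist_triangle3)
  also have "\<dots> < 2 * r i" using u[OF iI] i(2) by simp
  finally show False using v(3)[OF iI] by simp
qed

theorem theorem19:
  fixes \<psi> f :: "real \<Rightarrow> real"
  assumes psi_pos: "\<forall>r>0. \<psi> r > 0"
    and psi_decreasing: "antimono_on {0<..} \<psi>"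
    and psi_limit: "((\<lambda>r. r\<^sup>2 * \<psi> r) \<longlongrightarrow> 0) at_top"
    and f_dim: "dimension_function f"
    and f_limit: "filterlim (\<lambda>r. f r / r) at_top (at_right 0)"
    and f_decreasing: "antimono_on {0<..} (\<lambda>r. f r / r)"
  shows "(summable (\<lambda>n. f (\<psi> (real (Suc n)))) \<longrightarrow>
            hausdorff_measure f (circle_approximable \<psi>) = 0) \<and>
         (\<not> summable (\<lambda>n. f (\<psi> (real (Suc n)))) \<longrightarrow>
            hausdorff_measure f (circle_approximable \<psi>) = \<infinity>)"
proof -
  note f = dimension_functionD[OF f_dim]
  \<comment> \<open>The value at 0 is a filler, needed because \<open>\<psi>\<close> is controlled
    only at positive arguments; the condensation test asks for monotonicity only from index 1
    on.\<close>
  define a where "a n = (if n = 0 then 0 else f (\<psi> (real n)))" for n :: nat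
  have pos: "\<psi> (real n) > 0" if "0 < n" for n :: nat using psi_pos that by simp
  have "summable (\<lambda>n. f (\<psi> (real (Suc n)))) \<longleftrightarrow> summable (\<lambda>n. a (Suc n))"
    by (simp add: a_def)
  also have "\<dots> \<longleftrightarrow> summable a" by (rule summable_Suc_iff)
  also have "\<dots> \<longleftrightarrow> summable (\<lambda>k. 2 ^ k * a (2 ^ k))"
  proof (rule condensation_test)
    show "a (Suc m) \<le> a m" if "0 < m" for m
      using that f(2)[OF pos[of "Suc m"], of "\<psi> (real m)"] monotone_onD[OF psi_decreasing, of "real m" "real (Suc m)"]
      by (simp add: a_def)
    show "0 \<le> a n" for n using f(1)[OF pos, of n] by (auto simp: a_def intro: less_imp_le)
  qed
  also have "\<dots> \<longleftrightarrow> summable (\<lambda>k. 2 ^ k * f (\<psi> (2 ^ k)))"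
    by (simp add: a_def)
  finally have *: "summable (\<lambda>n. f (\<psi> (real (Suc n)))) \<longleftrightarrow> summable (\<lambda>k. 2 ^ k * f (\<psi> (2 ^ k)))" .
  show ?thesis
    unfolding * using hausdorff_measure_convergent[OF psi_pos psi_decreasing psi_limit f_dim f_decreasing]
      hausdorff_measure_divergent[OF psi_pos psi_decreasing psi_limit f_dim f_limit f_decreasing]
    by blast
qed

end
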